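(* Say a graph $H$ is defined by a subcubic graph $G$ if $G$ has a connected coalition partition $\pi$ with $CCG(G,\pi)\cong H$. Each of the graphs $K_1$, $\overline{K}_2$, $\overline{K}_3$, $K_4$, $\overline{K}_4$, $C_5$, $3K_2$, $K_{2,3}$, $K_{3,3}$ is defined by at least one but only finitely many (up to isomorphism) subcubic graphs. Each of the graphs $C_3$, $2K_2$, $P_4$, $C_4$, $C_3+e$, $K_4-e$, $P_2\cup P_3$, $S_{1,2}$, $P_5$, $C_3+e+e$, $C_3+2e$, $C_4+e$, $S_{2,2}$, and $S_k$ for every $k\ge 2$, is defined by infinitely many pairwise non-isomorphic subcubic graphs.
   Context: All graphs are finite and simple. A graph is subcubic if it is connected and its maximum vertex degree is at most 3. For a graph $G$ with vertex set $V$ and $S\subseteq V$, $G[S]$ denotes the induced subgraph. A set $D\subseteq V$ is dominating if every vertex of $V\setminus D$ has a neighbour in $D$; it is a connected dominating set if moreover $G[D]$ is connected. Two disjoint subsets $A,B\subseteq V$ form a connected coalition if neither $A$ nor $B$ is a connected dominating set but $A\cup B$ is a connected dominating set. A connected coalition partition of $G$ is a partition $\pi=\{V_1,\dots,V_k\}$ of $V$ such that each $V_i$ either is a connected dominating set consisting of a single vertex, or forms a connected coalition with some set of $\pi$. The coalition graph $CCG(G,\pi)$ has vertex set $\{V_1,\dots,V_k\}$, with $V_i$ and $V_j$ adjacent if and only if they form a connected coalition in $G$. Notation: $K_n,P_n,C_n$ are the complete graph, path and cycle of order $n$; $S_n$ is the star of order $n$ (i.e. $K_{1,n-1}$); $\overline{K}_n$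 is the edgeless graph on $n$ vertices; $mK_2$ is the disjoint union of $m$ copies of $K_2$; $P_2\cup P_3$ is the disjoint union of $P_2$ and $P_3$; $K_{p,q}$ is the complete bipartite graph; $K_4-e$ is $K_4$ minus one edge; $C_3+e$ is a triangle with one pendant vertex attached to one triangle vertex; $C_3+2e$ is a triangle with two pendant vertices attached to the same triangle vertex; $C_3+e+e$ is a triangle with two pendant vertices attached to two different triangle vertices; $C_4+e$ is a 4-cycle with one pendant vertex attached; $S_{1,2}$ is the unique 5-vertex tree other than $P_5$ and $S_5$ (a vertex of degree 3 one of whose neighbours has one further pendant neighbour); $S_{2,2}$ is the double star on 6 vertices: two adjacent vertices each having exactly two further pendant neighbours. *)

theory Defs
  imports "Graph_Theory.Graph_Theory" "HOL-Library.Disjoint_Sets"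
begin

text \<open>
  Finite simple graphs are the library's \<^locale>\<open>pair_graph\<close>s: finite loop-free digraphs
  with a symmetric arc relation, an undirected edge being a pair of opposite arcs.
  In particular \<^const>\<open>out_degree\<close> is the vertex degree.
\<close>

abbreviation graph_iso :: "'a pair_pre_digraph \<Rightarrow> 'b pair_pre_digraph \<Rightarrow> bool" where
  "graph_iso G H \<equiv> digraph_iso (with_proj G) (with_proj H)"

lemma graph_iso_iff:
  assumes G: "pair_wf_digraph G" and H: "pair_wf_digraph H"
  shows "graph_iso G H \<longleftrightarrow>
    (\<exists>f. bij_betw f (pverts G) (pverts H) \<and>
         (\<forall>u \<in> pverts G. \<forall>v \<in> pverts G. (u, v) \<in> parcs G \<longleftrightarrow> (f u, f v) \<in> parcs H))"
    (is "_ \<longleftrightarrow> (\<exists>f. ?iso f)")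
proof
  assume "graph_iso G H"
  then obtain h where h: "pre_digraph.digraph_isomorphism (with_proj G) h"
    and H_eq: "with_proj H = app_iso h (with_proj G)"
    by (auto simp: digraph_iso_def)
  have inj: "inj_on (iso_verts h) (pverts G)"
    using h by (simp add: pre_digraph.digraph_isomorphism_def)
  have verts: "pverts H = iso_verts h ` pverts G"
    using arg_cong[OF H_eq, of verts] by simp
  have "arcs_ends (with_proj H) =
      (\<lambda>(u, v). (iso_verts h u, iso_verts h v)) ` arcs_ends (with_proj G)"
    using h unfolding H_eq arcs_ends_conv
    by (force simp: pre_digraph.digraph_isomorphism_def)
  then have arcs: "parcs H = (\<lambda>(u, v). (iso_verts h u, iso_verts h v)) ` parcs G"
    by simp
  have "(u, v) \<in> parcs G \<longleftrightarrow> (iso_verts h u, iso_verts h v) \<in> parcs H"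
    if uv: "u \<in> pverts G" "v \<in> pverts G" for u v
  proof
    assume "(iso_verts h u, iso_verts h v) \<in> parcs H"
    then obtain u' v' where e: "(u', v') \<in> parcs G"
      and eq: "iso_verts h u = iso_verts h u'" "iso_verts h v = iso_verts h v'"
      unfolding arcs by auto
    with pair_wf_digraph.wellformed'[OF G e] uv inj have "u = u'" "v = v'"
      by (simp_all add: inj_on_eq_iff)
    with e show "(u, v) \<in> parcs G" by simp
  qed (force simp: arcs)
  then have "?iso (iso_verts h)"
    using inj verts by (simp add: bij_betw_def)
  then show "\<exists>f. ?iso f" by (intro exI[of _ "iso_verts h"])
next
  assume "\<exists>f. ?iso f"
  then obtain f where f: "?iso f" ..
  let ?h = "\<lparr> iso_verts = f, iso_arcs = (\<lambda>(u, v). (f u, f v)), iso_head = snd, iso_tail = fst \<rparr>"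
  have inj: "inj_on f (pverts G)" and im: "f ` pverts G = pverts H"
    using f by (auto simp: bij_betw_def)
  have wf: "parcs G \<subseteq> pverts G \<times> pverts G"
    using pair_wf_digraph.wellformed'[OF G] by auto
  have "inj_on (\<lambda>(u, v). (f u, f v)) (pverts G \<times> pverts G)"
    using map_prod_inj_on[OF inj inj] by (simp add: map_prod_def)
  then have inj_arcs: "inj_on (\<lambda>(u, v). (f u, f v)) (parcs G)"
    using wf by (rule inj_on_subset)
  have "pre_digraph.digraph_isomorphism (with_proj G) ?h"
    using inj inj_arcs G by (simp add: split_beta pre_digraph.digraph_isomorphism_def wf_digraph_wp_iff)
  moreover have "parcs H = (\<lambda>(u, v). (f u, f v)) ` parcs G"
  proof (intro set_eqI iffI)
    fix e assume e: "e \<in> parcs H"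
    obtain x y where xy: "e = (x, y)" by fastforce
    with e H have "x \<in> pverts H" "y \<in> pverts H"
      by (auto dest: pair_wf_digraph.wellformed')
    then obtain u v where "u \<in> pverts G" "v \<in> pverts G" "x = f u" "y = f v"
      using im by blast
    with f e xy show "e \<in> (\<lambda>(u, v). (f u, f v)) ` parcs G" by force
  next
    fix e assume "e \<in> (\<lambda>(u, v). (f u, f v)) ` parcs G"
    with f wf show "e \<in> parcs H" by auto
  qed
  then have "with_proj H = app_iso ?h (with_proj G)"
    using im by (simp add: app_iso_def with_proj_def)
  ultimately show "graph_iso G H" by (auto simp: digraph_iso_def)
qed

definition subcubic :: "'a pair_pre_digraph \<Rightarrow> bool" where
  "subcubic G \<longleftrightarrow> pair_graph G \<and> Digraph_Component.connected (with_proj G) \<and>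
     (\<forall>v \<in> pverts G. out_degree (with_proj G) v \<le> 3)"

definition dominating_set :: "'a pair_pre_digraph \<Rightarrow> 'a set \<Rightarrow> bool" where
  "dominating_set G D \<longleftrightarrow>
     D \<subseteq> pverts G \<and> (\<forall>v \<in> pverts G - D. \<exists>u \<in> D. (v, u) \<in> parcs G)"

definition connected_dominating_set :: "'a pair_pre_digraph \<Rightarrow> 'a set \<Rightarrow> bool" where
  "connected_dominating_set G D \<longleftrightarrow>
     dominating_set G D \<and> Digraph_Component.connected (with_proj G \<restriction> D)"

definition connected_coalition :: "'a pair_pre_digraph \<Rightarrow> 'a set \<Rightarrow> 'a set \<Rightarrow> bool" where
  "connected_coalition G A B \<longleftrightarrow>
     A \<subseteq> pverts G \<and> B \<subseteq> pverts G \<and> A \<inter> B = {} \<and>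
     \<not> connected_dominating_set G A \<and> \<not> connected_dominating_set G B \<and>
     connected_dominating_set G (A \<union> B)"

definition connected_coalition_partition ::
    "'a pair_pre_digraph \<Rightarrow> 'a set set \<Rightarrow> bool" where
  "connected_coalition_partition G \<pi> \<longleftrightarrow>
     partition_on (pverts G) \<pi> \<and>
     (\<forall>A \<in> \<pi>. (connected_dominating_set G A \<and> card A = 1) \<or>
               (\<exists>B \<in> \<pi>. connected_coalition G A B))"

definition CCG :: "'a pair_pre_digraph \<Rightarrow> 'a set set \<Rightarrow> 'a set pair_pre_digraph" where
  "CCG G \<pi> = \<lparr> pverts = \<pi>,
     parcs = {(A, B). A \<in> \<pi> \<and> B \<in> \<pi> \<and> connected_coalition G A B} \<rparr>"

text \<open>
  The subcubic graphs defining \<open>H\<close>. Every finite graph has an isomorphic copy on natural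
  numbers, so up to isomorphism nothing is lost by taking vertices in \<^typ>\<open>nat\<close>.
\<close>

definition defining_graphs :: "'b pair_pre_digraph \<Rightarrow> nat pair_pre_digraph set" where
  "defining_graphs H =
     {G. subcubic G \<and> (\<exists>\<pi>. connected_coalition_partition G \<pi> \<and> graph_iso (CCG G \<pi>) H)}"

definition finite_up_to_iso :: "'a pair_pre_digraph set \<Rightarrow> bool" where
  "finite_up_to_iso \<G> \<longleftrightarrow>
     (\<exists>\<F> \<subseteq> \<G>. finite \<F> \<and> (\<forall>G \<in> \<G>. \<exists>F \<in> \<F>. graph_iso G F))"

definition infinite_up_to_iso :: "'a pair_pre_digraph set \<Rightarrow> bool" where
  "infinite_up_to_iso \<G> \<longleftrightarrow>
     (\<exists>\<F> \<subseteq> \<G>. infinite \<F> \<and> pairwise (\<lambda>G H. \<not> graph_iso G H) \<F>)"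

definition graph_of_edges :: "nat \<Rightarrow> (nat \<times> nat) set \<Rightarrow> nat pair_pre_digraph" where
  "graph_of_edges n E = \<lparr> pverts = {0..<n}, parcs = E \<union> E\<inverse> \<rparr>"

lemma pair_graph_graph_of_edges:
  assumes "E \<subseteq> {0..<n} \<times> {0..<n}" "irrefl E"
  shows "pair_graph (graph_of_edges n E)"
proof -
  have "finite E" using assms(1) finite_subset by blast
  then show ?thesis
    using assms
    by unfold_locales
      (auto simp: graph_of_edges_def irrefl_def symmetric_def intro!: symI)
qed

definition complete_graph :: "nat \<Rightarrow> nat pair_pre_digraph" where
  "complete_graph n = graph_of_edges n {(i, j). i < j \<and> j < n}"

lemma complete_digraph_complete_graph: "K\<^bsub>n\<^esub> (with_proj (complete_graph n))"
  by (auto simp: complete_digraph_pair_def complete_graph_def graph_of_edges_def)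

definition edgeless_graph :: "nat \<Rightarrow> nat pair_pre_digraph" where
  "edgeless_graph n = graph_of_edges n {}"

definition path_graph :: "nat \<Rightarrow> nat pair_pre_digraph" where
  "path_graph n = graph_of_edges n {(i, Suc i) | i. Suc i < n}"

text \<open>Only meaningful for \<open>n \<ge> 3\<close>.\<close>

definition cycle_graph :: "nat \<Rightarrow> nat pair_pre_digraph" where
  "cycle_graph n = graph_of_edges n {(i, Suc i mod n) | i. i < n}"

definition complete_bipartite_graph :: "nat \<Rightarrow> nat \<Rightarrow> nat pair_pre_digraph" where
  "complete_bipartite_graph p q = graph_of_edges (p + q) ({0..<p} \<times> {p..<p + q})"

lemma complete_bipartite_digraph_complete_bipartite_graph:
  "K\<^bsub>p,q\<^esub> (with_proj (complete_bipartite_graph p q))"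
  unfolding complete_bipartite_digraph_pair_def
  by (intro conjI exI[of _ "{0..<p}"] exI[of _ "{p..<p + q}"])
    (auto simp: complete_bipartite_graph_def graph_of_edges_def)

text \<open>The index is the order, so the star with index \<open>n \<ge> 1\<close> has \<open>n - 1\<close> leaves.\<close>

definition star_graph :: "nat \<Rightarrow> nat pair_pre_digraph" where
  "star_graph n = complete_bipartite_graph 1 (n - 1)"

definition matching_graph :: "nat \<Rightarrow> nat pair_pre_digraph" where
  "matching_graph m = graph_of_edges (2 * m) {(2 * i, 2 * i + 1) | i. i < m}"

definition P2_union_P3 :: "nat pair_pre_digraph" where
  "P2_union_P3 = graph_of_edges 5 {(0, 1), (2, 3), (3, 4)}"

definition K4_minus_e :: "nat pair_pre_digraph" where
  "K4_minus_e = graph_of_edges 4 {(0, 1), (0, 2), (0, 3), (1, 2), (1, 3)}"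

definition C3_plus_e :: "nat pair_pre_digraph" where
  "C3_plus_e = graph_of_edges 4 {(0, 1), (1, 2), (2, 0), (0, 3)}"

definition C3_plus_2e :: "nat pair_pre_digraph" where
  "C3_plus_2e = graph_of_edges 5 {(0, 1), (1, 2), (2, 0), (0, 3), (0, 4)}"

definition C3_plus_e_plus_e :: "nat pair_pre_digraph" where
  "C3_plus_e_plus_e = graph_of_edges 5 {(0, 1), (1, 2), (2, 0), (0, 3), (1, 4)}"

definition C4_plus_e :: "nat pair_pre_digraph" where
  "C4_plus_e = graph_of_edges 5 {(0, 1), (1, 2), (2, 3), (3, 0), (0, 4)}"

definition S12_graph :: "nat pair_pre_digraph" where
  "S12_graph = graph_of_edges 5 {(0, 1), (0, 2), (0, 3), (3, 4)}"

definition S22_graph :: "nat pair_pre_digraph" where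
  "S22_graph = graph_of_edges 6 {(0, 1), (0, 2), (0, 3), (1, 4), (1, 5)}"

end

theory Submission
  imports Defs
begin

text \<open>
  In a subcubic graph with \<open>n\<close> vertices a connected dominating set \<open>D\<close> has at most \<open>card D + 2\<close>
  arcs leaving it, so \<open>n \<le> 2 * card D + 2\<close>. For \<open>H\<close> containing three disjoint edges or a 5-cycle
  through all vertices, adding up this bound over the edges bounds \<open>n\<close>; for \<open>K\<^sub>4\<close> and \<open>K\<^sub>2\<^sub>,\<^sub>3\<close> one counts
  arcs within and between the classes.

  The other graphs \<open>H\<close> except the stars have a vertex cover \<open>{\<alpha>, \<beta>}\<close> of size two. Each is defined
  by a graph containing a 4-cycle \<open>a1 a2 b2 b1\<close> with \<open>a1\<close>, \<open>a2\<close> in the class \<open>\<alpha>\<close> and \<open>b1\<close>, \<open>b2\<close> in the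
  class \<open>\<beta>\<close>. Subdividing \<open>a1 a2\<close> and \<open>b1 b2\<close> by new adjacent vertices \<open>a\<close> and \<open>b\<close> of these classes
  does not change the coalition graph: a union of classes that contains neither \<open>\<alpha>\<close> nor \<open>\<beta>\<close> does not
  dominate \<open>a\<close>, and it was not required to. The step can be repeated without end.
\<close>

section \<open>Connected sets and graphs up to isomorphism\<close>

text \<open>Give the edges of \<open>H\<close> weights with total at most 1 at every vertex. Summing
  \<open>n \<le> 2 * card D + 2\<close> over the edges gives
  \<open>w * n \<le> 2 * n + 2 * w\<close> for the total weight \<open>w\<close>, so
  \<open>n\<close> is bounded as soon as \<open>w > 2\<close>. For \<open>3K_2\<close> and
  \<open>K_{3,3}\<close> a matching has \<open>w = 3\<close>; for \<open>C_5\<close> weights 1/2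
  give \<open>w = 5/2\<close>. For \<open>K_4\<close> and \<open>K_{2,3}\<close> no weighting
  exceeds 2, which is why these two need the finer count of arcs between classes. A vertex cover of
  size two forces \<open>w \<le> 2\<close>, but it does not by itself make the family infinite:
  \<open>K_{2,3}\<close> has such a cover and is still defined finitely often. The 4-cycle in a
  starting graph is therefore a genuine requirement, and each starting graph is given explicitly and
  verified by evaluation. Evaluation cannot treat the stars, of which there are infinitely many;
  they get a family of host graphs with two parameters. Edgeless graphs need no bound on dominating
  sets: a class without a partner is a single vertex, so the order is the number of classes.\<close>

definition conn :: "'a rel \<Rightarrow> 'a set \<Rightarrow> bool" where
  "conn E S \<longleftrightarrow> S \<noteq> {} \<and> (\<forall>u\<in>S. \<forall>v\<in>S. (u, v) \<in> (E \<inter> S \<times> S)\<^sup>*)"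

text \<open>The library closure \<open>rtrancl_on\<close> is reflexive only on \<open>S\<close>, the
  ordinary closure everywhere; starting inside \<open>S\<close> removes the difference.\<close>

lemma rtrancl_on_eq:
  assumes "u \<in> S"
  shows "(u, v) \<in> rtrancl_on S E \<longleftrightarrow> (u, v) \<in> (E \<inter> S \<times> S)\<^sup>*"
proof
  assume "(u, v) \<in> rtrancl_on S E"
  then show "(u, v) \<in> (E \<inter> S \<times> S)\<^sup>*"
    by induct (auto intro: converse_rtrancl_into_rtrancl)
next
  assume "(u, v) \<in> (E \<inter> S \<times> S)\<^sup>*"
  then show "(u, v) \<in> rtrancl_on S E"
    using assms by induct (auto intro: rtrancl_on_into_rtrancl_on)
qed

lemma symcl_sym: "sym E \<Longrightarrow> E\<^sup>s = E"
  by (auto simp: symcl_def sym_def)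

lemma connected_with_proj_iff:
  assumes "sym (parcs G)" "parcs G \<subseteq> pverts G \<times> pverts G"
  shows "Digraph_Component.connected (with_proj G) \<longleftrightarrow> conn (parcs G) (pverts G)"
  using assms by (auto simp: connected_conv conn_def rtrancl_on_eq symcl_sym)

lemma connected_induce_iff:
  assumes "sym (parcs G)"
  shows "Digraph_Component.connected (with_proj G \<restriction> D) \<longleftrightarrow> conn (parcs G) D"
proof -
  have ends: "arcs_ends (with_proj G \<restriction> D) = parcs G \<inter> D \<times> D"
    by (auto simp: arcs_ends_conv induce_subgraph_def)
  have "sym (parcs G \<inter> D \<times> D)" using assms by (auto simp: sym_def)
  then show ?thesis
    by (auto simp: connected_conv conn_def rtrancl_on_eq symcl_sym ends Int_assoc)
qed

lemma connected_dominating_set_iff: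
  assumes "sym (parcs G)"
  shows "connected_dominating_set G D \<longleftrightarrow>
    D \<subseteq> pverts G \<and> (\<forall>v\<in>pverts G - D. \<exists>u\<in>D. (v, u) \<in> parcs G) \<and> conn (parcs G) D"
  using assms by (simp add: connected_dominating_set_def dominating_set_def connected_induce_iff)

lemma out_degree_with_proj: "out_degree (with_proj G) v = card (parcs G `` {v})"
proof -
  have "out_arcs (with_proj G) v = Pair v ` (parcs G `` {v})"
    by (auto simp: out_arcs_def)
  then show ?thesis
    by (simp add: out_degree_def card_image inj_on_def)
qed

text \<open>Trades the locale assumptions and the reachability of the library for conditions on a
  finite symmetric relation, the form in which subcubic graphs are used and constructed
  below.\<close>

lemma subcubic_iff:
  "subcubic G \<longleftrightarrow> finite (pverts G) \<and> parcs G \<subseteq> pverts G \<times> pverts G \<and> sym (parcs G) \<and>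
     irrefl (parcs G) \<and> conn (parcs G) (pverts G) \<and> (\<forall>v\<in>pverts G. card (parcs G `` {v}) \<le> 3)"
proof
  assume *: "subcubic G"
  then interpret pair_graph G by (simp add: subcubic_def)
  have 1: "parcs G \<subseteq> pverts G \<times> pverts G" by (auto dest: in_arcsD1 in_arcsD2)
  have 2: "sym (parcs G)" using pair_sym_arcs by (simp add: symmetric_def)
  have 3: "irrefl (parcs G)" using pair_no_loops by (fastforce simp: irrefl_def)
  show "finite (pverts G) \<and> parcs G \<subseteq> pverts G \<times> pverts G \<and> sym (parcs G) \<and>
     irrefl (parcs G) \<and> conn (parcs G) (pverts G) \<and> (\<forall>v\<in>pverts G. card (parcs G `` {v}) \<le> 3)"
    using * 1 2 3 pair_finite_verts connected_with_proj_iff[OF 2 1]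
    by (auto simp: subcubic_def out_degree_with_proj)
next
  assume *: "finite (pverts G) \<and> parcs G \<subseteq> pverts G \<times> pverts G \<and> sym (parcs G) \<and>
     irrefl (parcs G) \<and> conn (parcs G) (pverts G) \<and> (\<forall>v\<in>pverts G. card (parcs G `` {v}) \<le> 3)"
  then have fin: "finite (parcs G)" by (meson finite_SigmaI finite_subset)
  have "pair_graph G"
    using * fin by unfold_locales (auto simp: symmetric_def irrefl_def)
  then show "subcubic G" using * connected_with_proj_iff[of G]
    by (auto simp: subcubic_def out_degree_with_proj)
qed

text \<open>Arcs may be mapped to paths, in particular to trivial ones, so that \<open>f\<close> can
  contract arcs.\<close>

lemma conn_map:
  assumes "conn E' S'" "f ` S' = S"
    and "\<And>u v. (u, v) \<in> E' \<Longrightarrow> u \<in> S' \<Longrightarrow> v \<in> S' \<Longrightarrow> (f u, f v) \<in> (E \<inter> S \<times> S)\<^sup>*"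
  shows "conn E S"
proof -
  have "(f u, f v) \<in> (E \<inter> S \<times> S)\<^sup>*" if "(u, v) \<in> (E' \<inter> S' \<times> S')\<^sup>*" for u v
    using that
  proof induct
    case (step y z)
    then have "(f y, f z) \<in> (E \<inter> S \<times> S)\<^sup>*" using assms(3) by blast
    with step show ?case by (meson rtrancl_trans)
  qed simp
  then show ?thesis using assms(1,2) unfolding conn_def by blast
qed

text \<open>Made for subdivisions: an arc of the old graph may turn into a path of the new one, and
  every new vertex only has to reach an old one.\<close>

lemma conn_extend:
  assumes "conn E S" "sym E'"
    and edge: "\<And>u v. (u, v) \<in> E \<Longrightarrow> u \<in> S \<Longrightarrow> v \<in> S \<Longrightarrow> (u, v) \<in> (E' \<inter> S' \<times> S')\<^sup>*"
    and att: "\<And>x. x \<in> S' \<Longrightarrow> \<exists>y\<in>S. (x, y) \<in> (E' \<inter> S' \<times> S')\<^sup>*"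
    and "S \<subseteq> S'"
  shows "conn E' S'"
proof -
  have "sym (E' \<inter> S' \<times> S')" using assms(2) by (auto simp: sym_def)
  then have sym: "sym ((E' \<inter> S' \<times> S')\<^sup>*)" by (rule sym_rtrancl)
  have *: "(u, v) \<in> (E' \<inter> S' \<times> S')\<^sup>*" if "(u, v) \<in> (E \<inter> S \<times> S)\<^sup>*" for u v
    using that
  proof induct
    case (step y z)
    then have "(y, z) \<in> (E' \<inter> S' \<times> S')\<^sup>*" using edge by blast
    with step show ?case by (meson rtrancl_trans)
  qed simp
  have "(x, y) \<in> (E' \<inter> S' \<times> S')\<^sup>*" if xy: "x \<in> S'" "y \<in> S'" for x y
  proof -
    obtain x' y' where "x' \<in> S" "y' \<in> S" "(x, x') \<in> (E' \<inter> S' \<times> S')\<^sup>*" "(y, y') \<in> (E' \<inter> S' \<times> S')\<^sup>*"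
      using att[OF xy(1)] att[OF xy(2)] by blast
    moreover from this have "(x', y') \<in> (E' \<inter> S' \<times> S')\<^sup>*"
      using * assms(1) unfolding conn_def by blast
    ultimately show ?thesis using sym by (meson rtrancl_trans symD)
  qed
  then show ?thesis using assms(1,5) unfolding conn_def by blast
qed

text \<open>If no arc left \<open>T\<close>, everything reachable from \<open>T\<close> within
  \<open>S\<close> would stay in \<open>T\<close>. Serves both to grow connected sets vertex by
  vertex and to refute connectedness.\<close>

lemma conn_exit:
  assumes "conn E S" "T \<subseteq> S" "T \<noteq> {}" "T \<noteq> S"
  obtains u v where "u \<in> T" "v \<in> S - T" "(u, v) \<in> E"
proof -
  obtain x y where xy: "x \<in> T" "y \<in> S" "y \<notin> T" using assms by blast
  have "z \<in> T" if "(x, z) \<in> (E \<inter> S \<times> S)\<^sup>*" "\<forall>u\<in>T. \<forall>v\<in>S - T. (u, v) \<notin> E" for z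
    using that by induct (use xy in auto)
  then show ?thesis using assms xy that unfolding conn_def by blast
qed

section \<open>Finiteness and infinity up to isomorphism, read off from the orders\<close>

lemma finite_up_to_iso_if_card_bounded:
  fixes \<G> :: "nat pair_pre_digraph set"
  assumes wf: "\<And>G. G \<in> \<G> \<Longrightarrow> pair_wf_digraph G"
    and fin: "\<And>G. G \<in> \<G> \<Longrightarrow> finite (pverts G)"
    and card: "\<And>G. G \<in> \<G> \<Longrightarrow> card (pverts G) \<le> N"
  shows "finite_up_to_iso \<G>"
proof -
  define iso where "iso G H f \<longleftrightarrow> bij_betw f (pverts G) (pverts H) \<and>
         (\<forall>u \<in> pverts G. \<forall>v \<in> pverts G. (u, v) \<in> parcs G \<longleftrightarrow> (f u, f v) \<in> parcs H)"
    for G H :: "nat pair_pre_digraph" and f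
  define K where "K = (\<lambda>(V, E). \<lparr>pverts = V, parcs = E\<rparr>) ` (Pow {0..<N} \<times> Pow ({0..<N} \<times> {0..<N}))"
  have finK: "finite K" by (simp add: K_def)
  have code: "\<exists>R\<in>K. \<exists>f. iso G R f" if G: "G \<in> \<G>" for G
  proof -
    obtain f where f: "bij_betw f (pverts G) {0..<card (pverts G)}"
      using ex_bij_betw_finite_nat[OF fin[OF G]] by blast
    define R where "R = \<lparr>pverts = {0..<card (pverts G)}, parcs = map_prod f f ` parcs G\<rparr>"
    have w: "parcs G \<subseteq> pverts G \<times> pverts G"
      using pair_wf_digraph.wellformed'[OF wf[OF G]] by auto
    have "f ` pverts G \<subseteq> {0..<N}" using f card[OF G] by (auto simp: bij_betw_def)
    with w have "map_prod f f ` parcs G \<subseteq> {0..<N} \<times> {0..<N}" by auto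
    then have "R \<in> K" unfolding K_def R_def using card[OF G]
      by (intro image_eqI[of _ _ "({0..<card (pverts G)}, map_prod f f ` parcs G)"]) auto
    moreover have "iso G R f"
    proof -
      have inj: "inj_on f (pverts G)" using f by (simp add: bij_betw_def)
      have "(u, v) \<in> parcs G" if "u \<in> pverts G" "v \<in> pverts G" "(f u, f v) \<in> map_prod f f ` parcs G" for u v
        using that w by (auto simp: inj_on_eq_iff[OF inj] subset_iff)
      then show ?thesis unfolding iso_def R_def using f by force
    qed
    ultimately show ?thesis by blast
  qed
  \<comment> \<open>The copy \<open>R\<close> on an initial segment is not known to lie in
    \<open>\<G>\<close>, so every copy that occurs is replaced by a member of \<open>\<G>\<close>
    isomorphic to it.\<close>
  define rep where "rep R = (SOME G. G \<in> \<G> \<and> (\<exists>f. iso G R f))" for R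
  define \<F> where "\<F> = rep ` {R\<in>K. \<exists>G\<in>\<G>. \<exists>f. iso G R f}"
  have rep: "rep R \<in> \<G> \<and> (\<exists>f. iso (rep R) R f)" if "\<exists>G\<in>\<G>. \<exists>f. iso G R f" for R
    unfolding rep_def by (rule someI_ex) (use that in blast)
  have "\<exists>F\<in>\<F>. graph_iso G F" if G: "G \<in> \<G>" for G
  proof -
    obtain R f where R: "R \<in> K" "iso G R f" using code[OF G] by blast
    then have ex: "\<exists>G\<in>\<G>. \<exists>f. iso G R f" using G by blast
    then obtain g where g: "iso (rep R) R g" "rep R \<in> \<G>" using rep by blast
    let ?h = "inv_into (pverts (rep R)) g \<circ> f"
    have gi: "bij_betw (inv_into (pverts (rep R)) g) (pverts R) (pverts (rep R))"
      using g by (auto simp: iso_def intro: bij_betw_inv_into)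
    have "bij_betw ?h (pverts G) (pverts (rep R))"
      using R(2) gi by (auto simp: iso_def intro: bij_betw_trans)
    moreover have "(u, v) \<in> parcs G \<longleftrightarrow> (?h u, ?h v) \<in> parcs (rep R)"
      if uv: "u \<in> pverts G" "v \<in> pverts G" for u v
    proof -
      have fu: "f u \<in> pverts R" "f v \<in> pverts R" using R uv by (auto simp: iso_def bij_betw_def)
      then have "?h u \<in> pverts (rep R)" "?h v \<in> pverts (rep R)"
        using gi by (auto simp: bij_betw_def)
      moreover have "g (?h u) = f u" "g (?h v) = f v"
        using fu g(1) by (auto simp: iso_def bij_betw_def f_inv_into_f)
      ultimately have "(?h u, ?h v) \<in> parcs (rep R) \<longleftrightarrow> (f u, f v) \<in> parcs R"
        using g(1) unfolding iso_def by metis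
      then show ?thesis using R(2) uv unfolding iso_def by blast
    qed
    ultimately have "graph_iso G (rep R)"
      using graph_iso_iff[OF wf[OF G] wf[OF g(2)]] by blast
    then show ?thesis using R(1) ex unfolding \<F>_def by blast
  qed
  moreover have "\<F> \<subseteq> \<G>" unfolding \<F>_def using rep by blast
  moreover have "finite \<F>" unfolding \<F>_def using finK by simp
  ultimately show ?thesis unfolding finite_up_to_iso_def by blast
qed

lemma infinite_up_to_iso_if_card_unbounded:
  assumes wf: "\<And>G. G \<in> \<G> \<Longrightarrow> pair_wf_digraph G"
    and unb: "\<And>m. \<exists>G\<in>\<G>. card (pverts G) \<ge> m"
  shows "infinite_up_to_iso \<G>"
proof -
  define K where "K = (\<lambda>G. card (pverts G)) ` \<G>"
  have "infinite K"
    unfolding infinite_nat_iff_unbounded_le K_def using unb by blast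
  \<comment> \<open>One graph for each order that occurs; different orders already exclude an
    isomorphism.\<close>
  define rep where "rep = inv_into \<G> (\<lambda>G. card (pverts G))"
  have rep: "rep m \<in> \<G>" "card (pverts (rep m)) = m" if "m \<in> K" for m
    using that unfolding K_def rep_def by (auto intro: inv_into_into f_inv_into_f)
  have "inj_on rep K" by (metis inj_onI rep(2))
  with \<open>infinite K\<close> have "infinite (rep ` K)" by (simp add: finite_image_iff)
  moreover have "pairwise (\<lambda>G H. \<not> graph_iso G H) (rep ` K)"
  proof (rule pairwiseI)
    fix G H assume GH: "G \<in> rep ` K" "H \<in> rep ` K" "G \<noteq> H"
    then have "card (pverts G) \<noteq> card (pverts H)" using rep by auto
    moreover have "pair_wf_digraph G" "pair_wf_digraph H" using GH rep wf by auto
    ultimately show "\<not> graph_iso G H"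
      using graph_iso_iff by (auto dest: bij_betw_same_card)
  qed
  ultimately show ?thesis
    unfolding infinite_up_to_iso_def using rep by blast
qed

section \<open>Bounds on the order\<close>

lemma pair_wf_digraph_graph_of_edges:
  "E \<subseteq> {0..<n} \<times> {0..<n} \<Longrightarrow> pair_wf_digraph (graph_of_edges n E)"
  by unfold_locales (auto simp: graph_of_edges_def)

lemma pair_wf_digraph_if_subcubic: "subcubic G \<Longrightarrow> pair_wf_digraph G"
  by (auto simp: subcubic_iff pair_wf_digraph_def)

text \<open>Inverting the isomorphism indexes the classes by the vertices of \<open>H\<close>. The
  last conclusion keeps what remains of the partition condition at an isolated vertex of
  \<open>H\<close>, namely that its class is a single vertex.\<close>

lemma defining_graphs_obtain_classes:
  assumes G: "G \<in> defining_graphs H" and H: "pair_wf_digraph H"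
  obtains P where "subcubic G" "(\<Union>h\<in>pverts H. P h) = pverts G"
    "\<And>h. h \<in> pverts H \<Longrightarrow> P h \<noteq> {}"
    "\<And>h h'. h \<in> pverts H \<Longrightarrow> h' \<in> pverts H \<Longrightarrow> h \<noteq> h' \<Longrightarrow> P h \<inter> P h' = {}"
    "\<And>h h'. h \<in> pverts H \<Longrightarrow> h' \<in> pverts H \<Longrightarrow>
       (h, h') \<in> parcs H \<longleftrightarrow> connected_coalition G (P h) (P h')"
    "\<And>h. h \<in> pverts H \<Longrightarrow> card (P h) = 1 \<or> (\<exists>h'\<in>pverts H. (h, h') \<in> parcs H)"
proof -
  obtain \<pi> where sub: "subcubic G" and ccp: "connected_coalition_partition G \<pi>"
    and iso: "graph_iso (CCG G \<pi>) H"
    using G unfolding defining_graphs_def by blast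
  have "pair_wf_digraph (CCG G \<pi>)" by unfold_locales (auto simp: CCG_def)
  from iso graph_iso_iff[OF this H] obtain f where f: "bij_betw f \<pi> (pverts H)"
    and fe: "\<And>A B. A \<in> \<pi> \<Longrightarrow> B \<in> \<pi> \<Longrightarrow> connected_coalition G A B \<longleftrightarrow> (f A, f B) \<in> parcs H"
    by (auto simp: CCG_def)
  define P where "P = inv_into \<pi> f"
  have P: "bij_betw P (pverts H) \<pi>" unfolding P_def using f by (rule bij_betw_inv_into)
  have fP: "f (P h) = h" if "h \<in> pverts H" for h
    unfolding P_def using f that by (rule bij_betw_inv_into_right)
  have mem: "P h \<in> \<pi>" if "h \<in> pverts H" for h using P that by (auto simp: bij_betw_def)
  have part: "partition_on (pverts G) \<pi>" using ccp by (simp add: connected_coalition_partition_def)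
  have edge: "(h, h') \<in> parcs H \<longleftrightarrow> connected_coalition G (P h) (P h')"
    if "h \<in> pverts H" "h' \<in> pverts H" for h h'
    using fe[OF mem mem] fP that by simp
  show ?thesis
  proof
    show "subcubic G" by fact
    show "(\<Union>h\<in>pverts H. P h) = pverts G"
      using partition_onD1[OF part] P by (auto simp: bij_betw_def)
    show "P h \<noteq> {}" if "h \<in> pverts H" for h
      using partition_onD3[OF part] mem[OF that] by metis
    show "P h \<inter> P h' = {}" if "h \<in> pverts H" "h' \<in> pverts H" "h \<noteq> h'" for h h'
    proof -
      have "P h \<noteq> P h'" using fP[OF that(1)] fP[OF that(2)] that(3) by auto
      then show ?thesis
        by (rule disjointD[OF partition_onD2[OF part] mem[OF that(1)] mem[OF that(2)]])
    qed
    show "(h, h') \<in> parcs H \<longleftrightarrow> connected_coalition G (P h) (P h')"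
      if "h \<in> pverts H" "h' \<in> pverts H" for h h'
      using edge that by blast
    show "card (P h) = 1 \<or> (\<exists>h'\<in>pverts H. (h, h') \<in> parcs H)" if h: "h \<in> pverts H" for h
    proof (rule disjCI)
      assume "\<not> (\<exists>h'\<in>pverts H. (h, h') \<in> parcs H)"
      moreover have "(f (P h), f B) \<in> parcs H" "f B \<in> pverts H"
        if "B \<in> \<pi>" "connected_coalition G (P h) B" for B
        using fe[OF mem[OF h]] that f by (auto simp: bij_betw_def)
      ultimately have "\<not> (\<exists>B\<in>\<pi>. connected_coalition G (P h) B)" using fP[OF h] by metis
      then show "card (P h) = 1"
        using ccp mem[OF h] unfolding connected_coalition_partition_def by blast
    qed
  qed
qed

section \<open>Counting arcs in a subcubic graph\<close>

locale subcubic_graph =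
  fixes G :: "'a pair_pre_digraph"
  assumes subcubic: "subcubic G"
begin

abbreviation "V \<equiv> pverts G"
abbreviation "E \<equiv> parcs G"
abbreviation "cds \<equiv> connected_dominating_set G"

lemma finite_V: "finite V" and E_sub: "E \<subseteq> V \<times> V" and sym_E: "sym E" and irrefl_E: "irrefl E"
  and degree_le: "v \<in> V \<Longrightarrow> card (E `` {v}) \<le> 3"
  using subcubic by (auto simp: subcubic_iff)

lemma finite_E: "finite E"
  using finite_V E_sub by (meson finite_SigmaI finite_subset)

lemma finite_nbrs: "finite (E `` {v})"
  using finite_E by (rule finite_Image)

text \<open>Ordered arcs are counted, so an edge inside \<open>S\<close> counts twice in
  \<open>arcs_between S S\<close>. This makes the count additive in both arguments and bounded by
  three per vertex.\<close>

definition arcs_between :: "'a set \<Rightarrow> 'a set \<Rightarrow> nat" where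
  "arcs_between S T = card (E \<inter> S \<times> T)"

lemma arcs_between_commute: "arcs_between S T = arcs_between T S"
proof -
  have "E \<inter> T \<times> S = prod.swap ` (E \<inter> S \<times> T)" using sym_E by (auto simp: sym_def)
  then show ?thesis by (simp add: arcs_between_def card_image)
qed

lemma arcs_between_Un_right:
  "T \<inter> U = {} \<Longrightarrow> arcs_between S (T \<union> U) = arcs_between S T + arcs_between S U"
  using finite_E unfolding arcs_between_def
  by (subst card_Un_disjoint[symmetric]) (auto intro!: arg_cong[where f = card])

lemma arcs_between_Un_left:
  "T \<inter> U = {} \<Longrightarrow> arcs_between (T \<union> U) S = arcs_between T S + arcs_between U S"
  by (simp add: arcs_between_commute[of _ S] arcs_between_Un_right)

lemma arcs_between_eq_sum:
  "finite S \<Longrightarrow> arcs_between S T = (\<Sum>v\<in>S. card (E `` {v} \<inter> T))"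
proof -
  assume "finite S"
  have "E \<inter> S \<times> T = Sigma S (\<lambda>v. E `` {v} \<inter> T)" by auto
  then show ?thesis
    using \<open>finite S\<close> finite_nbrs by (simp add: arcs_between_def card_SigmaI)
qed

lemma arcs_between_ge:
  assumes "finite S" "\<And>v. v \<in> S \<Longrightarrow> k \<le> card (E `` {v} \<inter> T)"
  shows "k * card S \<le> arcs_between S T"
  using sum_mono[of S "\<lambda>_. k" "\<lambda>v. card (E `` {v} \<inter> T)"] assms
  by (simp add: arcs_between_eq_sum mult.commute)

lemma arcs_between_le: "S \<subseteq> V \<Longrightarrow> arcs_between S T \<le> 3 * card S"
proof -
  assume S: "S \<subseteq> V"
  have "card (E `` {v} \<inter> T) \<le> 3" if "v \<in> S" for v
    using degree_le[of v] card_mono[OF finite_nbrs, of "E `` {v} \<inter> T" v] S that by fastforce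
  then show ?thesis
    using sum_bounded_above[of S "\<lambda>v. card (E `` {v} \<inter> T)" 3] finite_subset[OF S finite_V]
    by (simp add: arcs_between_eq_sum mult.commute)
qed

lemma arcs_between_pos:
  "(u, v) \<in> E \<Longrightarrow> u \<in> S \<Longrightarrow> v \<in> T \<Longrightarrow> 1 \<le> arcs_between S T"
proof -
  assume "(u, v) \<in> E" "u \<in> S" "v \<in> T"
  then have "E \<inter> S \<times> T \<noteq> {}" by blast
  then show ?thesis using finite_E by (simp add: arcs_between_def Suc_le_eq card_gt_0_iff)
qed

lemma nbr_count_pos: "(v, u) \<in> E \<Longrightarrow> u \<in> T \<Longrightarrow> 1 \<le> card (E `` {v} \<inter> T)"
proof -
  assume "(v, u) \<in> E" "u \<in> T"
  then have "E `` {v} \<inter> T \<noteq> {}" by blast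
  then show ?thesis using finite_nbrs[of v] by (simp add: Suc_le_eq card_gt_0_iff)
qed

lemma conn_card_arcs:
  assumes "conn E S" "finite S"
  shows "2 * card S \<le> arcs_between S S + 2"
proof -
  \<comment> \<open>A spanning tree in disguise: \<open>k\<close> is its number of edges so far, and
    every added vertex brings at least one arc in each direction.\<close>
  have "Suc k \<le> card S \<Longrightarrow> \<exists>T\<subseteq>S. card T = Suc k \<and> 2 * k \<le> arcs_between T T" for k
  proof (induct k)
    case 0
    then obtain x where "x \<in> S" using assms by (auto simp: conn_def)
    then show ?case by (intro exI[of _ "{x}"]) auto
  next
    case (Suc k)
    then obtain T where T: "T \<subseteq> S" "card T = Suc k" "2 * k \<le> arcs_between T T" by auto
    then have "T \<noteq> {}" "T \<noteq> S" using Suc by auto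
    with assms T obtain u v where uv: "u \<in> T" "v \<in> S - T" "(u, v) \<in> E"
      by (meson conn_exit)
    have "arcs_between (T \<union> {v}) (T \<union> {v}) =
        arcs_between T T + 2 * arcs_between T {v} + arcs_between {v} {v}"
      using uv arcs_between_commute[of T "{v}"]
      by (simp add: arcs_between_Un_left arcs_between_Un_right del: Un_insert_right)
    moreover have "1 \<le> arcs_between T {v}" using uv by (intro arcs_between_pos) auto
    ultimately have "2 * Suc k \<le> arcs_between (T \<union> {v}) (T \<union> {v})" using T by simp
    moreover have "card (T \<union> {v}) = Suc (Suc k)"
      using T uv finite_subset[OF T(1) assms(2)] by simp
    ultimately show ?case using T uv by (intro exI[of _ "T \<union> {v}"]) auto
  qed
  moreover have "card S \<noteq> 0" using assms by (auto simp: conn_def)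
  ultimately obtain T where T: "T \<subseteq> S" "card T = card S" "2 * (card S - 1) \<le> arcs_between T T"
    by (metis Suc_pred' le_refl neq0_conv)
  then have "T = S" using card_subset_eq assms by blast
  with T show ?thesis by simp
qed

lemma cds_iff: "cds D \<longleftrightarrow> D \<subseteq> V \<and> (\<forall>v\<in>V - D. \<exists>u\<in>D. (v, u) \<in> E) \<and> conn E D"
  by (rule connected_dominating_set_iff[OF sym_E])

lemma finite_sub: "D \<subseteq> V \<Longrightarrow> finite D"
  using finite_V finite_subset by blast

text \<open>Connectedness keeps at least \<open>2 * card D - 2\<close> of the at most
  \<open>3 * card D\<close> arcs from \<open>D\<close> inside \<open>D\<close>; each vertex outside
  \<open>D\<close> receives one of the others.\<close>

lemma card_V_le_if_cds:
  assumes "cds D"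
  shows "card V \<le> 2 * card D + 2"
proof -
  have D: "D \<subseteq> V" "\<And>v. v \<in> V - D \<Longrightarrow> \<exists>u\<in>D. (v, u) \<in> E" "conn E D"
    using assms by (auto simp: cds_iff)
  have "1 * card (V - D) \<le> arcs_between (V - D) D"
    using finite_V nbr_count_pos D(2) by (intro arcs_between_ge) fast+
  moreover have "arcs_between D D + arcs_between D (V - D) \<le> 3 * card D"
    using arcs_between_le[OF D(1), of V] arcs_between_Un_right[of D "V - D" D] D(1)
    by (simp add: Un_absorb1)
  moreover have "card V = card D + card (V - D)"
    using D(1) finite_V by (metis card_Diff_subset card_mono finite_subset le_add_diff_inverse)
  ultimately show ?thesis
    using conn_card_arcs[OF D(3) finite_sub[OF D(1)]] arcs_between_commute[of D "V - D"] by linarith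
qed

lemma cds_Un_card_arcs:
  assumes "cds (A \<union> B)" "A \<inter> B = {}"
  shows "2 * (card A + card B) \<le>
    arcs_between A A + 2 * arcs_between A B + arcs_between B B + 2"
proof -
  have "finite (A \<union> B)" "conn E (A \<union> B)" using assms finite_sub by (auto simp: cds_iff)
  then show ?thesis
    using conn_card_arcs[of "A \<union> B"] assms(2) arcs_between_commute[of A B]
    by (simp add: arcs_between_Un_left arcs_between_Un_right card_Un_disjoint)
qed

lemma card_V_le_if_cds_Un:
  assumes "cds (A \<union> B)"
  shows "card V \<le> 2 * (card A + card B) + 2"
  using card_V_le_if_cds[OF assms] card_Un_le[of A B] by simp

text \<open>
  A vertex is dominated by each of the three pairs formed by the other classes, so it has two
  neighbours outside its own class and at most one inside. Connectedness of the six unions needs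
  more arcs than that once there are more than twelve vertices.
\<close>

lemma card_V_le_if_pairwise_cds:
  assumes V: "V = (\<Union>i<4. P i)"
    and disj: "\<And>i j. i < (4::nat) \<Longrightarrow> j < 4 \<Longrightarrow> i \<noteq> j \<Longrightarrow> P i \<inter> P j = {}"
    and cds: "\<And>i j. i < 4 \<Longrightarrow> j < 4 \<Longrightarrow> i \<noteq> j \<Longrightarrow> cds (P i \<union> P j)"
  shows "card V \<le> 12"
proof -
  have sub: "P i \<subseteq> V" if "i < 4" for i using V that by auto
  have inner: "arcs_between (P i) (P i) \<le> card (P i)" if i: "i < 4" for i
  proof -
    have "2 \<le> card (E `` {v} \<inter> (V - P i))" if v: "v \<in> P i" for v
    proof (rule ccontr)
      assume "\<not> ?thesis"
      then have "card (E `` {v} \<inter> (V - P i)) \<le> 1" by simp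
      then have uniq: "x = y" if "(v, x) \<in> E" "(v, y) \<in> E" "x \<in> V - P i" "y \<in> V - P i" for x y
        using that finite_nbrs card_le_Suc0_iff_eq[of "E `` {v} \<inter> (V - P i)"] by auto
      have dom: "\<exists>u\<in>P j \<union> P k. (v, u) \<in> E" if "j < 4" "k < 4" "j \<noteq> k" "i \<noteq> j" "i \<noteq> k" for j k
        using cds[OF that(1-3)] v disj[OF i that(1)] disj[OF i that(2)] that sub[OF i]
        by (auto simp: cds_iff)
      have out: "u \<in> V - P i" if "u \<in> P j" "j < 4" "i \<noteq> j" for u j
        using that disj[OF i that(2,3)] sub by blast
      \<comment> \<open>The three indices other than \<open>i\<close>, in increasing order.\<close>
      define j k l :: nat where "j = (if i = 0 then 1 else 0)"
        and "k = (if i \<le> 1 then 2 else 1)" and "l = (if i \<le> 2 then 3 else 2)"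
      have jkl: "j < 4" "k < 4" "l < 4" "i \<noteq> j" "i \<noteq> k" "i \<noteq> l" "j \<noteq> k" "j \<noteq> l" "k \<noteq> l"
        using i by (auto simp: j_def k_def l_def)
      obtain x y z where x: "x \<in> P j \<union> P k" "(v, x) \<in> E"
        and y: "y \<in> P j \<union> P l" "(v, y) \<in> E" and z: "z \<in> P k \<union> P l" "(v, z) \<in> E"
        using dom[of j k] dom[of j l] dom[of k l] jkl by auto
      have "x \<in> V - P i" "y \<in> V - P i" "z \<in> V - P i"
        using x(1) y(1) z(1) out[OF _ jkl(1,4)] out[OF _ jkl(2,5)] out[OF _ jkl(3,6)] by blast+
      \<comment> \<open>A single outside neighbour would lie in all three pairwise unions of the
        disjoint classes \<open>P j\<close>, \<open>P k\<close>, \<open>P l\<close>, which have no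
        common element.\<close>
      then have "x = y" "x = z" using uniq x(2) y(2) z(2) by blast+
      then show False
        using x(1) y(1) z(1) disj[OF jkl(1,2,7)] disj[OF jkl(1,3,8)] disj[OF jkl(2,3,9)] by blast
    qed
    then have "2 * card (P i) \<le> arcs_between (P i) (V - P i)"
      using finite_sub[OF sub[OF i]] by (intro arcs_between_ge) auto
    moreover have "arcs_between (P i) (P i) + arcs_between (P i) (V - P i) \<le> 3 * card (P i)"
      using arcs_between_le[OF sub[OF i], of V] sub[OF i]
        arcs_between_Un_right[of "P i" "V - P i" "P i"]
      by (simp add: Un_absorb1)
    ultimately show ?thesis by linarith
  qed
  have four: "{..<4} = {0, 1, 2, 3::nat}" by auto
  have cardV: "card V = card (P 0) + card (P 1) + card (P 2) + card (P 3)"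
    using V disj finite_sub[OF sub] by (subst V, subst card_UN_disjoint) (auto simp: four)
  have deg: "arcs_between (P i) (P 0) + arcs_between (P i) (P 1) + arcs_between (P i) (P 2)
      + arcs_between (P i) (P 3) \<le> 3 * card (P i)" if "i < 4" for i
  proof -
    have "V = P 0 \<union> (P 1 \<union> (P 2 \<union> P 3))" using V by (auto simp: four)
    moreover have "P 0 \<inter> (P 1 \<union> (P 2 \<union> P 3)) = {}" "P 1 \<inter> (P 2 \<union> P 3) = {}" "P 2 \<inter> P 3 = {}"
      using disj by (auto simp: Int_Un_distrib)
    ultimately show ?thesis
      using arcs_between_le[OF sub[OF that], of V] by (simp add: arcs_between_Un_right)
  qed
  have pair: "2 * (card (P i) + card (P j)) \<le>
    arcs_between (P i) (P i) + 2 * arcs_between (P i) (P j) + arcs_between (P j) (P j) + 2"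
    if "i < 4" "j < 4" "i \<noteq> j" for i j
    using cds_Un_card_arcs cds disj that by metis
  define e where "e i j = arcs_between (P i) (P j)" for i j
  have comm: "e i j = e j i" for i j
    unfolding e_def by (rule arcs_between_commute)
  \<comment> \<open>The sum of \<open>pair\<close> over the six pairs; every class occurs in three
    of them.\<close>
  have "6 * (card (P 0) + card (P 1) + card (P 2) + card (P 3)) \<le>
      3 * (e 0 0 + e 1 1 + e 2 2 + e 3 3) + 2 * (e 0 1 + e 0 2 + e 0 3 + e 1 2 + e 1 3 + e 2 3) + 12"
    using pair[of 0 1] pair[of 0 2] pair[of 0 3] pair[of 1 2] pair[of 1 3] pair[of 2 3]
    unfolding e_def[symmetric] by simp
  moreover have "(e 0 0 + e 1 1 + e 2 2 + e 3 3) + 2 * (e 0 1 + e 0 2 + e 0 3 + e 1 2 + e 1 3 + e 2 3)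
      \<le> 3 * (card (P 0) + card (P 1) + card (P 2) + card (P 3))"
    using deg[of 0] deg[of 1] deg[of 2] deg[of 3]
    unfolding e_def[symmetric]
    unfolding comm[of 1 0] comm[of 2 0] comm[of 3 0] comm[of 2 1] comm[of 3 1] comm[of 3 2]
    by simp
  moreover have "e 0 0 + e 1 1 + e 2 2 + e 3 3 \<le> card (P 0) + card (P 1) + card (P 2) + card (P 3)"
    using inner[of 0] inner[of 1] inner[of 2] inner[of 3]
    unfolding e_def[symmetric] by simp
  \<comment> \<open>Here \<open>x\<close> counts the arcs within classes and \<open>y\<close> the
    edges between them: \<open>3 * x + 2 * y\<close> is \<open>2 * x\<close> plus
    \<open>x + 2 * y\<close>, hence at most \<open>5 * n\<close>.\<close>
  moreover have "n \<le> 12" if "6 * n \<le> 3 * x + 2 * y + 12" "x + 2 * y \<le> 3 * n" "x \<le> n" for n x y :: nat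
    using that by linarith
  ultimately show ?thesis unfolding cardV by blast
qed

text \<open>Adding \<open>card_V_le_if_cds\<close> for two disjoint sets gives
  \<open>2 * n \<le> 2 * (n - card X) + 4\<close>: two disjoint edges do not bound the order, but
  they bound what they leave uncovered.\<close>

lemma card_V_le_if_disjoint_cds:
  assumes "cds (A \<union> B)" "cds (C \<union> D)"
    and "A \<inter> B = {}" "A \<inter> C = {}" "A \<inter> D = {}" "B \<inter> C = {}" "B \<inter> D = {}" "C \<inter> D = {}"
    and "X \<subseteq> V" "X \<inter> (A \<union> B \<union> C \<union> D) = {}"
  shows "card X \<le> 2"
proof -
  have fin: "finite A" "finite B" "finite C" "finite D" "finite X"
    and sub: "A \<union> B \<union> C \<union> D \<union> X \<subseteq> V"
    using assms finite_sub by (auto simp: cds_iff)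
  have "(A \<union> B) \<inter> (C \<union> D) = {}" "(A \<union> B \<union> (C \<union> D)) \<inter> X = {}" using assms by blast+
  then have "card (A \<union> B \<union> (C \<union> D) \<union> X) = card (A \<union> B) + card (C \<union> D) + card X"
    using fin by (simp add: card_Un_disjoint)
  moreover have "card (A \<union> B \<union> (C \<union> D) \<union> X) \<le> card V"
    using sub finite_V by (intro card_mono) auto
  ultimately show ?thesis
    using card_V_le_if_cds[OF assms(1)] card_V_le_if_cds[OF assms(2)] by linarith
qed

text \<open>
  Vertices of \<open>A\<close> without a neighbour in \<open>A'\<close> are adjacent to all three sets \<open>B i\<close>, hence isolated
  in \<open>A\<close>. The other vertices of \<open>A\<close> each spend one of their three arcs on \<open>A'\<close>, which leaves too
  few arcs for \<open>A \<union> B i\<close> to be connected for all three \<open>i\<close>. So \<open>A\<close> has at most as many vertices as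
  the union of the \<open>B i\<close>.
\<close>

lemma card_V_le_if_complete_bipartite:
  assumes V: "V = A \<union> A' \<union> B 0 \<union> B 1 \<union> B 2"
    and disjA: "A \<inter> A' = {}" and disjB: "\<And>i. i < (3::nat) \<Longrightarrow> A \<inter> B i = {}" "\<And>i. i < 3 \<Longrightarrow> A' \<inter> B i = {}"
    and disj: "\<And>i j. i < 3 \<Longrightarrow> j < 3 \<Longrightarrow> i \<noteq> j \<Longrightarrow> B i \<inter> B j = {}"
    and ne: "\<And>i. i < 3 \<Longrightarrow> B i \<noteq> {}"
    and cds: "\<And>i. i < 3 \<Longrightarrow> cds (A \<union> B i)" "\<And>i. i < 3 \<Longrightarrow> cds (A' \<union> B i)"
  shows "card V \<le> 18"
proof -
  have three: "i < 3 \<longleftrightarrow> i = 0 \<or> i = 1 \<or> i = 2" for i :: nat by auto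
  have sub: "A \<subseteq> V" "A' \<subseteq> V" "i < 3 \<Longrightarrow> B i \<subseteq> V" for i using V by (auto simp: three)
  have fin: "finite A" "finite A'" "i < 3 \<Longrightarrow> finite (B i)" for i using sub finite_sub by auto
  have B_le: "card (B i) \<le> 2" if "i < 3" for i
  proof -
    \<comment> \<open>With the other two indices, \<open>A \<union> B j\<close> and
      \<open>A' \<union> B k\<close> are disjoint connected dominating sets that miss
      \<open>B i\<close>.\<close>
    have "\<exists>j k. j < 3 \<and> k < 3 \<and> i \<noteq> j \<and> i \<noteq> k \<and> j \<noteq> k"
      by (rule exI[of _ "if i = 0 then 1 else 0"], rule exI[of _ "if i = 2 then 1 else 2"])
        (use that in auto)
    then obtain j k where jk: "j < 3" "k < 3" "i \<noteq> j" "i \<noteq> k" "j \<noteq> k" by blast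
    have *: "B j \<inter> A' = {}" "B i \<inter> (A \<union> B j \<union> A' \<union> B k) = {}"
      using disjB[OF jk(1)] disjB[OF that] disj[OF that jk(1,3)] disj[OF that jk(2,4)] by blast+
    show ?thesis
      using card_V_le_if_disjoint_cds[OF cds(1)[OF jk(1)] cds(2)[OF jk(2)] disjB(1)[OF jk(1)] disjA
          disjB(1)[OF jk(2)] *(1) disj[OF jk(1,2,5)] disjB(2)[OF jk(2)] sub(3)[OF that] *(2)] .
  qed
  \<comment> \<open>For \<open>m\<close> equal to 1 or 2, \<open>m * (m - 1)\<close> is
    \<open>2 * m - 2\<close>. The \<open>2\<close> on the left absorbs the additive \<open>2\<close>
    of \<open>cds_Un_card_arcs\<close>.\<close>
  have B_inner: "arcs_between (B i) (B i) + 2 \<le> 2 * card (B i)" if i: "i < 3" for i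
  proof -
    have "card (E `` {v} \<inter> B i) \<le> card (B i) - 1" if "v \<in> B i" for v
    proof -
      have "E `` {v} \<inter> B i \<subseteq> B i - {v}" using irrefl_E by (auto simp: irrefl_def)
      then show ?thesis using that fin(3)[OF i] by (metis card_Diff_singleton card_mono finite_Diff)
    qed
    then have "arcs_between (B i) (B i) \<le> card (B i) * (card (B i) - 1)"
      using sum_bounded_above[of "B i" "\<lambda>v. card (E `` {v} \<inter> B i)" "card (B i) - 1"] fin(3)[OF i]
      by (simp add: arcs_between_eq_sum)
    moreover have "card (B i) = 1 \<or> card (B i) = 2"
      using B_le[OF i] ne[OF i] fin(3)[OF i] by (metis One_nat_def card_0_eq le_SucE le_zero_eq numeral_2_eq_2)
    ultimately show ?thesis by auto
  qed
  define U where "U = B 0 \<union> (B 1 \<union> B 2)"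
  have disjU: "B 0 \<inter> (B 1 \<union> B 2) = {}" "B 1 \<inter> B 2 = {}"
    using disj[of 0 1] disj[of 0 2] disj[of 1 2] by auto
  have U: "arcs_between S U = arcs_between S (B 0) + arcs_between S (B 1) + arcs_between S (B 2)" for S
    using disjU by (simp add: U_def arcs_between_Un_right)
  have V': "V = A \<union> (A' \<union> U)" "A \<inter> (A' \<union> U) = {}" "A' \<inter> U = {}"
    using V disjA disjB(1)[of 0] disjB(1)[of 1] disjB(1)[of 2] disjB(2)[of 0] disjB(2)[of 1] disjB(2)[of 2]
    by (auto simp: U_def)
  have deg: "arcs_between S A + arcs_between S A' + arcs_between S U \<le> 3 * card S" if "S \<subseteq> V" for S
    using arcs_between_le[OF that, of V] V' by (simp add: arcs_between_Un_right)
  define W where "W = {v \<in> A. \<forall>u\<in>A'. (v, u) \<notin> E}"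
  define X where "X = A - W"
  have WX: "A = W \<union> X" "W \<inter> X = {}" "finite W" "finite X" "W \<subseteq> V" "X \<subseteq> V"
    using fin sub by (auto simp: W_def X_def)
  have W_deg: "3 \<le> card (E `` {v} \<inter> U)" if v: "v \<in> W" for v
  proof -
    have nb: "\<exists>u\<in>B i. (v, u) \<in> E" if "i < 3" for i
      using cds(2)[OF that] v disjA disjB(1)[OF that] sub(1) by (fastforce simp: cds_iff W_def)
    obtain x y z where xyz: "x \<in> B 0" "y \<in> B 1" "z \<in> B 2" "(v, x) \<in> E" "(v, y) \<in> E" "(v, z) \<in> E"
      using nb[of 0] nb[of 1] nb[of 2] by auto
    then have "x \<noteq> y" "x \<noteq> z" "y \<noteq> z" using disjU by blast+
    then have "card {x, y, z} = 3" by simp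
    moreover have "{x, y, z} \<subseteq> E `` {v} \<inter> U" using xyz by (auto simp: U_def)
    ultimately show ?thesis using card_mono[of "E `` {v} \<inter> U" "{x, y, z}"] finite_nbrs by auto
  qed
  have WU: "3 * card W \<le> arcs_between W U"
    using WX W_deg by (intro arcs_between_ge) auto
  then have WA: "arcs_between W A = 0" "arcs_between W U = 3 * card W" using deg[OF WX(5)] by auto
  have WA_none: "(w, v) \<notin> E" if "w \<in> W" "v \<in> A" for w v
    using arcs_between_pos[of w v W A] that WA by auto
  have "X = {}"
  proof (rule ccontr)
    assume ne: "X \<noteq> {}"
    have "arcs_between W W = 0" "arcs_between X W = 0" "arcs_between W X = 0"
      using WA(1) WX(2) arcs_between_Un_right[of W X W] arcs_between_commute[of X W]
      unfolding WX(1) by auto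
    then have AA: "arcs_between A A = arcs_between X X" "arcs_between X A = arcs_between X X"
      unfolding WX(1) using WX(2) by (simp_all add: arcs_between_Un_right arcs_between_Un_left)
    have "1 * card X \<le> arcs_between X A'"
      using WX nbr_count_pos by (intro arcs_between_ge) (auto simp: X_def W_def)
    then have 1: "arcs_between X X + arcs_between X U \<le> 2 * card X"
      using deg[OF WX(6)] AA by simp
    have "2 * card A \<le> arcs_between A A + 2 * arcs_between A (B i)" if "i < 3" for i
      using cds_Un_card_arcs[OF cds(1)[OF that] disjB(1)[OF that]] B_inner[OF that] by simp
    from this[of 0] this[of 1] this[of 2] have "6 * card A \<le> 3 * arcs_between A A + 2 * arcs_between A U"
      unfolding U by simp
    moreover have "arcs_between A U = 3 * card W + arcs_between X U"
      using WA(2) WX(2) unfolding WX(1) by (simp add: arcs_between_Un_left)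
    moreover have "card A = card W + card X" using WX by (simp add: card_Un_disjoint)
    ultimately have 2: "6 * card X \<le> 3 * arcs_between X X + 2 * arcs_between X U"
      unfolding AA by simp
    \<comment> \<open>Facts 1 and 2 are only just compatible: three times the first against the
      second leaves \<open>arcs_between X U = 0\<close>. An arc leaving \<open>X\<close> within
      \<open>A \<union> B 0\<close> cannot end in \<open>W\<close>, so it ends in \<open>U\<close>
      and contradicts this.\<close>
    have "X \<noteq> A \<union> B 0" using ne disjB(1)[of 0] \<open>\<And>i. i < 3 \<Longrightarrow> B i \<noteq> {}\<close>[of 0] by (auto simp: X_def)
    then obtain u v where uv: "u \<in> X" "v \<in> A \<union> B 0 - X" "(u, v) \<in> E"
      using conn_exit[of E "A \<union> B 0" X] cds(1)[of 0] ne by (auto simp: cds_iff X_def)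
    have "v \<notin> W" using WA_none[of v u] uv sym_E by (auto simp: X_def sym_def)
    then have "v \<in> U" using uv by (auto simp: X_def U_def)
    then have "1 \<le> arcs_between X U" using uv by (intro arcs_between_pos)
    with 1 2 show False by linarith
  qed
  then have "3 * card A \<le> arcs_between U A"
    using WU WX arcs_between_commute[of U A] by simp
  also have "\<dots> \<le> 3 * card U" using V' by (intro arcs_between_le) auto
  also have "card U \<le> card (B 0) + (card (B 1) + card (B 2))"
    unfolding U_def using card_Un_le[of "B 0" "B 1 \<union> B 2"] card_Un_le[of "B 1" "B 2"] by linarith
  finally have "card A \<le> 6" using B_le[of 0] B_le[of 1] B_le[of 2] by simp
  \<comment> \<open>The bound 18 is \<open>2 * (6 + 2) + 2\<close>.\<close>
  then show ?thesis using card_V_le_if_cds_Un[OF cds(1)[of 0]] B_le[of 0] by simp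
qed

end

section \<open>The graphs defined by finitely many subcubic graphs\<close>

lemma finite_up_to_iso_defining_graphs:
  assumes "\<And>G. G \<in> defining_graphs H \<Longrightarrow> card (pverts G) \<le> N"
  shows "finite_up_to_iso (defining_graphs H)"
proof (rule finite_up_to_iso_if_card_bounded[where N = N])
  fix G assume "G \<in> defining_graphs H"
  then show "pair_wf_digraph G" "finite (pverts G)" "card (pverts G) \<le> N"
    using assms by (auto simp: defining_graphs_def subcubic_iff pair_wf_digraph_if_subcubic)
qed

lemma pverts_graph_of_edges [simp]: "pverts (graph_of_edges n E) = {0..<n}"
  and parcs_graph_of_edges [simp]: "parcs (graph_of_edges n E) = E \<union> E\<inverse>"
  by (simp_all add: graph_of_edges_def)

lemma defining_graphs_graph_of_edges_obtain_classes:
  assumes "G \<in> defining_graphs (graph_of_edges n F)" "F \<subseteq> {0..<n} \<times> {0..<n}"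
  obtains P where "subcubic_graph G" "(\<Union>i<n. P i) = pverts G"
    "\<And>i. i < n \<Longrightarrow> P i \<noteq> {}" "\<And>i. i < n \<Longrightarrow> P i \<subseteq> pverts G"
    "\<And>i j. i < n \<Longrightarrow> j < n \<Longrightarrow> i \<noteq> j \<Longrightarrow> P i \<inter> P j = {}"
    "\<And>i j. (i, j) \<in> F \<union> F\<inverse> \<Longrightarrow> connected_dominating_set G (P i \<union> P j)"
    "\<And>i. i < n \<Longrightarrow> card (P i) = 1 \<or> (\<exists>j<n. (i, j) \<in> F \<union> F\<inverse>)"
proof (rule defining_graphs_obtain_classes[OF assms(1) pair_wf_digraph_graph_of_edges[OF assms(2)],
      unfolded pverts_graph_of_edges parcs_graph_of_edges])
  fix P assume P: "subcubic G" "(\<Union>i\<in>{0..<n}. P i) = pverts G"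
    "\<And>i. i \<in> {0..<n} \<Longrightarrow> P i \<noteq> {}"
    "\<And>i j. i \<in> {0..<n} \<Longrightarrow> j \<in> {0..<n} \<Longrightarrow> i \<noteq> j \<Longrightarrow> P i \<inter> P j = {}"
    "\<And>i j. i \<in> {0..<n} \<Longrightarrow> j \<in> {0..<n} \<Longrightarrow>
       (i, j) \<in> F \<union> F\<inverse> \<longleftrightarrow> connected_coalition G (P i) (P j)"
    "\<And>i. i \<in> {0..<n} \<Longrightarrow> card (P i) = 1 \<or> (\<exists>j\<in>{0..<n}. (i, j) \<in> F \<union> F\<inverse>)"
  show ?thesis
  proof (rule that)
    show "subcubic_graph G" using P(1) by unfold_locales
    show "connected_dominating_set G (P i \<union> P j)" if "(i, j) \<in> F \<union> F\<inverse>" for i j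
      using that P(5)[of i j] assms(2) by (auto simp: connected_coalition_def)
    show "(\<Union>i<n. P i) = pverts G" using P(2) by (simp add: lessThan_atLeast0)
    then show "P i \<subseteq> pverts G" if "i < n" for i using that by blast
    show "card (P i) = 1 \<or> (\<exists>j<n. (i, j) \<in> F \<union> F\<inverse>)" if "i < n" for i
      using P(6)[of i] that by auto
  qed (use P(3,4) in auto)
qed

lemma card_V_eq_sum_classes:
  assumes "(\<Union>i<n. P i) = V" "finite V" "\<And>i j. i < n \<Longrightarrow> j < n \<Longrightarrow> i \<noteq> j \<Longrightarrow> P i \<inter> P j = {}"
  shows "card V = (\<Sum>i<(n::nat). card (P i))"
proof -
  have "finite (P i)" if "i < n" for i using assms(1,2) that by (auto intro: finite_subset)
  then show ?thesis unfolding assms(1)[symmetric] using assms(3) by (intro card_UN_disjoint) auto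
qed

lemma finite_up_to_iso_complete_graph_4: "finite_up_to_iso (defining_graphs (complete_graph 4))"
proof (rule finite_up_to_iso_defining_graphs)
  fix G :: "nat pair_pre_digraph" assume "G \<in> defining_graphs (complete_graph 4)"
  then have G: "G \<in> defining_graphs (graph_of_edges 4 {(i, j). i < j \<and> j < 4})"
    by (simp add: complete_graph_def)
  have F: "{(i, j). i < j \<and> j < 4} \<subseteq> {0..<4} \<times> {0..<4::nat}" by auto
  obtain P where P: "subcubic_graph G" "(\<Union>i<4. P i) = pverts G"
    "\<And>i j. i < 4 \<Longrightarrow> j < 4 \<Longrightarrow> i \<noteq> j \<Longrightarrow> P i \<inter> P j = {}"
    "\<And>i j. (i, j) \<in> {(i, j). i < j \<and> j < 4} \<union> {(i, j). i < j \<and> j < (4::nat)}\<inverse> \<Longrightarrow>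
      connected_dominating_set G (P i \<union> P j)"
    by (rule defining_graphs_graph_of_edges_obtain_classes[OF G F]) (rule that; assumption)
  show "card (pverts G) \<le> 12"
    by (rule subcubic_graph.card_V_le_if_pairwise_cds[OF P(1) P(2)[symmetric] P(3) P(4)]) auto
qed

text \<open>Every class lies on two of the five edges, so the sum of the five bounds is
  \<open>5 * n \<le> 4 * n + 10\<close>.\<close>

lemma finite_up_to_iso_cycle_graph_5: "finite_up_to_iso (defining_graphs (cycle_graph 5))"
proof (rule finite_up_to_iso_defining_graphs)
  let ?E = "{(i, Suc i mod 5) | i. i < 5}"
  fix G :: "nat pair_pre_digraph" assume "G \<in> defining_graphs (cycle_graph 5)"
  then have G: "G \<in> defining_graphs (graph_of_edges 5 ?E)"
    by (simp add: cycle_graph_def)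
  have F: "?E \<subseteq> {0..<5} \<times> {0..<5::nat}" by auto
  obtain P where P: "subcubic_graph G" "(\<Union>i<5. P i) = pverts G"
    "\<And>i j. i < 5 \<Longrightarrow> j < 5 \<Longrightarrow> i \<noteq> j \<Longrightarrow> P i \<inter> P j = {}"
    "\<And>i j. (i, j) \<in> ?E \<union> ?E\<inverse> \<Longrightarrow> connected_dominating_set G (P i \<union> P j)"
    by (rule defining_graphs_graph_of_edges_obtain_classes[OF G F]) (rule that; assumption)
  interpret subcubic_graph G by (rule P(1))
  have *: "card V \<le> 2 * (card (P i) + card (P j)) + 2"
    if "(i, j) \<in> {(0, 1), (1, 2), (2, 3), (3, 4), (4, 0)}" for i j
    using that by (intro card_V_le_if_cds_Un P(4)) auto
  have "card V = card (P 0) + card (P 1) + card (P 2) + card (P 3) + card (P 4)"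
  proof -
    have "{..<5} = {0, 1, 2, 3, 4::nat}" by auto
    then show ?thesis using card_V_eq_sum_classes[OF P(2) finite_V P(3)] by simp
  qed
  then show "card V \<le> 10"
    using *[of 0 1] *[of 1 2] *[of 2 3] *[of 3 4] *[of 4 0] by simp
qed

text \<open>The three edges meet each of the six classes once, so the sum of their bounds is
  \<open>3 * n \<le> 2 * n + 6\<close>.\<close>

lemma card_le_if_3_disjoint_edges:
  assumes G: "G \<in> defining_graphs (graph_of_edges 6 F)" and F: "F \<subseteq> {0..<6} \<times> {0..<6}"
    and e: "(a, b) \<in> F \<union> F\<inverse>" "(c, d) \<in> F \<union> F\<inverse>" "(e, f) \<in> F \<union> F\<inverse>"
    and d: "distinct [a, b, c, d, e, f]"
  shows "card (pverts G) \<le> 6"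
proof -
  obtain P where P: "subcubic_graph G" "(\<Union>i<6. P i) = pverts G"
    "\<And>i j. i < 6 \<Longrightarrow> j < 6 \<Longrightarrow> i \<noteq> j \<Longrightarrow> P i \<inter> P j = {}"
    "\<And>i j. (i, j) \<in> F \<union> F\<inverse> \<Longrightarrow> connected_dominating_set G (P i \<union> P j)"
    by (rule defining_graphs_graph_of_edges_obtain_classes[OF G F]) (rule that; assumption)
  interpret subcubic_graph G by (rule P(1))
  have sub: "{a, b, c, d, e, f} \<subseteq> {..<6}" using e F by auto
  have "card {a, b, c, d, e, f} = 6" using d by simp
  then have "{a, b, c, d, e, f} = {..<6}" using sub by (intro card_subset_eq) auto
  then have "card V = (\<Sum>i\<in>{a, b, c, d, e, f}. card (P i))"
    using card_V_eq_sum_classes[OF P(2) finite_V P(3)] by simp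
  also have "\<dots> = card (P a) + card (P b) + card (P c) + card (P d) + card (P e) + card (P f)"
    using d by simp
  finally show ?thesis
    using card_V_le_if_cds_Un[OF P(4)[OF e(1)]] card_V_le_if_cds_Un[OF P(4)[OF e(2)]]
      card_V_le_if_cds_Un[OF P(4)[OF e(3)]] by simp
qed

lemma finite_up_to_iso_matching_graph_3: "finite_up_to_iso (defining_graphs (matching_graph 3))"
proof (rule finite_up_to_iso_defining_graphs)
  fix G :: "nat pair_pre_digraph" assume "G \<in> defining_graphs (matching_graph 3)"
  then have G: "G \<in> defining_graphs (graph_of_edges 6 {(2 * i, 2 * i + 1) | i. i < 3})"
    by (simp add: matching_graph_def)
  have mem: "(2 * i, 2 * i + 1) \<in> {(2 * i, 2 * i + 1) | i. i < (3::nat)} \<union> S" if "i < 3" for i S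
    using that by blast
  show "card (pverts G) \<le> 6"
    by (rule card_le_if_3_disjoint_edges[OF G _ mem[of 0] mem[of 1] mem[of 2]]) auto
qed

lemma finite_up_to_iso_complete_bipartite_graph_3_3:
  "finite_up_to_iso (defining_graphs (complete_bipartite_graph 3 3))"
proof (rule finite_up_to_iso_defining_graphs)
  fix G :: "nat pair_pre_digraph" assume "G \<in> defining_graphs (complete_bipartite_graph 3 3)"
  then have G: "G \<in> defining_graphs (graph_of_edges 6 ({0..<3} \<times> {3..<6}))"
    by (simp add: complete_bipartite_graph_def)
  show "card (pverts G) \<le> 6"
    by (rule card_le_if_3_disjoint_edges[OF G, of 0 3 1 4 2 5]) auto
qed

lemma finite_up_to_iso_complete_bipartite_graph_2_3:
  "finite_up_to_iso (defining_graphs (complete_bipartite_graph 2 3))"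
proof (rule finite_up_to_iso_defining_graphs)
  let ?E = "{0..<2::nat} \<times> {2..<5::nat}"
  fix G :: "nat pair_pre_digraph" assume "G \<in> defining_graphs (complete_bipartite_graph 2 3)"
  then have G: "G \<in> defining_graphs (graph_of_edges 5 ?E)"
    by (simp add: complete_bipartite_graph_def)
  have F: "?E \<subseteq> {0..<5} \<times> {0..<5::nat}" by auto
  obtain P where P: "subcubic_graph G" "(\<Union>i<5. P i) = pverts G"
    "\<And>i. i < 5 \<Longrightarrow> P i \<noteq> {}"
    "\<And>i j. i < 5 \<Longrightarrow> j < 5 \<Longrightarrow> i \<noteq> j \<Longrightarrow> P i \<inter> P j = {}"
    "\<And>i j. (i, j) \<in> ?E \<union> ?E\<inverse> \<Longrightarrow> connected_dominating_set G (P i \<union> P j)"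
    by (rule defining_graphs_graph_of_edges_obtain_classes[OF G F]) (rule that; assumption)
  have "{..<5} = {0, 1, 2, 3, 4::nat}" by auto
  \<comment> \<open>The unevaluated sums are there to match \<open>B 0\<close>, \<open>B 1\<close>,
    \<open>B 2\<close> for \<open>B i = P (2 + i)\<close>.\<close>
  then have V: "pverts G = P 0 \<union> P 1 \<union> P (2 + 0) \<union> P (2 + 1) \<union> P (2 + 2)"
    using P(2) by auto
  show "card (pverts G) \<le> 18"
  proof (rule subcubic_graph.card_V_le_if_complete_bipartite[OF P(1) V])
    fix i :: nat assume i: "i < 3"
    show "P (2 + i) \<noteq> {}" "P 0 \<inter> P (2 + i) = {}" "P 1 \<inter> P (2 + i) = {}"
      using i by (intro P(3,4); simp)+
    show "connected_dominating_set G (P 0 \<union> P (2 + i))" "connected_dominating_set G (P 1 \<union> P (2 + i))"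
      using i by (intro P(5); simp)+
    show "P (2 + i) \<inter> P (2 + j) = {}" if "j < 3" "i \<noteq> j" for j
      using i that by (intro P(4)) auto
  qed (intro P(4); simp)
qed

lemma complete_graph_1: "complete_graph 1 = edgeless_graph 1"
  by (auto simp: complete_graph_def edgeless_graph_def graph_of_edges_def)

lemma finite_up_to_iso_edgeless_graph: "finite_up_to_iso (defining_graphs (edgeless_graph n))"
proof (rule finite_up_to_iso_defining_graphs)
  fix G :: "nat pair_pre_digraph" assume "G \<in> defining_graphs (edgeless_graph n)"
  then have G: "G \<in> defining_graphs (graph_of_edges n {})"
    by (simp add: edgeless_graph_def)
  have F: "{} \<subseteq> {0..<n} \<times> {0..<n}" by auto
  obtain P where P: "subcubic_graph G" "(\<Union>i<n. P i) = pverts G"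
    "\<And>i j. i < n \<Longrightarrow> j < n \<Longrightarrow> i \<noteq> j \<Longrightarrow> P i \<inter> P j = {}"
    "\<And>i. i < n \<Longrightarrow> card (P i) = 1 \<or> (\<exists>j<n. (i, j) \<in> {} \<union> {}\<inverse>)"
    by (rule defining_graphs_graph_of_edges_obtain_classes[OF G F]) (rule that; assumption)
  interpret subcubic_graph G by (rule P(1))
  show "card V \<le> n"
    using card_V_eq_sum_classes[OF P(2) finite_V P(3)] P(4) by simp
qed

text \<open>In a complete graph every single vertex is already a connected dominating set, so no two
  classes form a coalition. The degree bound limits this host to four vertices.\<close>

lemma edgeless_graph_defined:
  assumes "1 \<le> n" "n \<le> 4"
  shows "defining_graphs (edgeless_graph n) \<noteq> {}"
proof -
  let ?G = "complete_graph n" and ?\<pi> = "(\<lambda>i. {i}) ` {0..<n}"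
  have pv: "pverts ?G = {0..<n}" by (simp add: complete_graph_def)
  have arcs: "(i, j) \<in> parcs ?G \<longleftrightarrow> i < n \<and> j < n \<and> i \<noteq> j" for i j
    by (auto simp: complete_graph_def)
  have conn: "conn (parcs ?G) S" if "S \<noteq> {}" "S \<subseteq> {0..<n}" for S
  proof -
    have "(u, v) \<in> (parcs ?G \<inter> S \<times> S)\<^sup>*" if "u \<in> S" "v \<in> S" for u v
      using that \<open>S \<subseteq> _\<close> by (cases "u = v") (auto simp: arcs subset_iff intro!: r_into_rtrancl)
    with that show ?thesis by (simp add: conn_def)
  qed
  have sym: "sym (parcs ?G)" by (auto simp: sym_def arcs)
  have "card (parcs ?G `` {v}) \<le> 3" if "v < n" for v
  proof -
    have "card (parcs ?G `` {v}) \<le> card ({0..<n} - {v})" by (rule card_mono) (auto simp: arcs)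
    then show ?thesis using that assms(2) by simp
  qed
  then have sub: "subcubic ?G"
    unfolding subcubic_iff pv using conn[of "{0..<n}"] sym assms(1) by (auto simp: arcs irrefl_def)
  have cds: "connected_dominating_set ?G {i}" if "i < n" for i
    using conn[of "{i}"] that by (auto simp: connected_dominating_set_iff[OF sym] pv arcs)
  have part: "partition_on {0..<n} ?\<pi>"
    by (auto intro!: partition_onI simp: disjnt_def)
  have "connected_coalition_partition ?G ?\<pi>"
    unfolding connected_coalition_partition_def pv using part cds by auto
  moreover have "graph_iso (CCG ?G ?\<pi>) (edgeless_graph n)"
  proof -
    have wf: "pair_wf_digraph (CCG ?G ?\<pi>)" "pair_wf_digraph (edgeless_graph n)"
      by (unfold_locales, auto simp: CCG_def edgeless_graph_def)
    have "bij_betw the_elem ?\<pi> {0..<n}" by (auto simp: bij_betw_def inj_on_def image_image)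
    moreover have "\<not> connected_coalition ?G A B" if "A \<in> ?\<pi>" for A B
      using that cds by (auto simp: connected_coalition_def)
    ultimately show ?thesis
      unfolding graph_iso_iff[OF wf] by (intro exI[of _ the_elem]) (auto simp: CCG_def edgeless_graph_def)
  qed
  ultimately show ?thesis using sub unfolding defining_graphs_def by blast
qed

section \<open>Colourings and their verification by computation\<close>

definition colour_class :: "'a pair_pre_digraph \<Rightarrow> ('a \<Rightarrow> 'b) \<Rightarrow> 'b \<Rightarrow> 'a set" where
  "colour_class G c h = {v \<in> pverts G. c v = h}"

text \<open>
  A partition is given as the colouring \<open>c\<close> that maps every vertex of its \<open>h\<close>-th class to the
  vertex \<open>h\<close> of \<open>H\<close>. Graphs \<open>H\<close> with isolated vertices are excluded.
\<close>

definition realizes :: "'a pair_pre_digraph \<Rightarrow> ('a \<Rightarrow> 'b) \<Rightarrow> 'b pair_pre_digraph \<Rightarrow> bool" where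
  "realizes G c H \<longleftrightarrow> subcubic G \<and> c ` pverts G = pverts H \<and>
     (\<forall>h\<in>pverts H. \<not> connected_dominating_set G (colour_class G c h)) \<and>
     (\<forall>h\<in>pverts H. \<exists>h'\<in>pverts H. (h, h') \<in> parcs H) \<and>
     (\<forall>h\<in>pverts H. \<forall>h'\<in>pverts H. h \<noteq> h' \<longrightarrow>
        ((h, h') \<in> parcs H \<longleftrightarrow>
          connected_dominating_set G (colour_class G c h \<union> colour_class G c h')))"

text \<open>Classes of different colours are nonempty and disjoint, so sending a class back to its
  colour is the isomorphism. As \<open>H\<close> has no isolated vertices, every class has a
  partner.\<close>

lemma defining_graphs_if_realizes:
  assumes "realizes G c H" and wf: "pair_wf_digraph H" and "irrefl (parcs H)"
  shows "G \<in> defining_graphs H"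
proof -
  let ?P = "colour_class G c" and ?\<pi> = "colour_class G c ` pverts H"
  have r: "subcubic G" "c ` pverts G = pverts H"
    "\<And>h. h \<in> pverts H \<Longrightarrow> \<not> connected_dominating_set G (?P h)"
    "\<And>h. h \<in> pverts H \<Longrightarrow> \<exists>h'\<in>pverts H. (h, h') \<in> parcs H"
    "\<And>h h'. h \<in> pverts H \<Longrightarrow> h' \<in> pverts H \<Longrightarrow> h \<noteq> h' \<Longrightarrow>
        (h, h') \<in> parcs H \<longleftrightarrow> connected_dominating_set G (?P h \<union> ?P h')"
    using assms(1) unfolding realizes_def by blast+
  have ne: "?P h \<noteq> {}" if "h \<in> pverts H" for h
    using that unfolding r(2)[symmetric] by (auto simp: colour_class_def)
  have disj: "?P h \<inter> ?P h' = {}" if "h \<noteq> h'" for h h'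
    using that by (auto simp: colour_class_def)
  have inj: "inj_on ?P (pverts H)"
  proof (rule inj_onI)
    fix h h' assume "h \<in> pverts H" "?P h = ?P h'"
    then show "h = h'" using ne[of h] disj[of h h'] by auto
  qed
  have coal: "connected_coalition G (?P h) (?P h') \<longleftrightarrow> (h, h') \<in> parcs H"
    if h: "h \<in> pverts H" "h' \<in> pverts H" for h h'
  proof (cases "h = h'")
    case True
    then show ?thesis using ne[OF h(1)] assms(3) by (auto simp: connected_coalition_def irrefl_def)
  next
    case False
    have "?P h \<subseteq> pverts G" "?P h' \<subseteq> pverts G" by (auto simp: colour_class_def)
    then show ?thesis
      using r(3)[OF h(1)] r(3)[OF h(2)] r(5)[OF h False] disj[OF False]
      by (simp add: connected_coalition_def)
  qed
  have "partition_on (pverts G) ?\<pi>"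
  proof (rule partition_onI)
    show "\<Union>?\<pi> = pverts G" using r(2) by (auto simp: colour_class_def)
    show "disjnt A B" if AB: "A \<in> ?\<pi>" "B \<in> ?\<pi>" "A \<noteq> B" for A B
    proof -
      obtain h h' where "A = ?P h" "B = ?P h'" using AB(1,2) by blast
      then show ?thesis using AB(3) disj[of h h'] unfolding disjnt_def by blast
    qed
    show "{} \<notin> ?\<pi>" using ne by (metis imageE)
  qed
  then have "connected_coalition_partition G ?\<pi>"
    unfolding connected_coalition_partition_def
  proof (intro conjI ballI disjI2)
    fix A assume "A \<in> ?\<pi>"
    then obtain h where h: "h \<in> pverts H" "A = ?P h" by blast
    then obtain h' where "h' \<in> pverts H" "(h, h') \<in> parcs H" using r(4) by blast
    then show "\<exists>B\<in>?\<pi>. connected_coalition G A B" using h coal by blast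
  qed
  moreover have "graph_iso (CCG G ?\<pi>) H"
  proof -
    have "pair_wf_digraph (CCG G ?\<pi>)" by unfold_locales (auto simp: CCG_def)
    moreover have "bij_betw (inv_into (pverts H) ?P) ?\<pi> (pverts H)"
      using inj by (intro bij_betw_inv_into) (simp add: bij_betw_def)
    ultimately show ?thesis
      unfolding graph_iso_iff[OF \<open>pair_wf_digraph (CCG G ?\<pi>)\<close> wf]
      using coal by (intro exI[of _ "inv_into (pverts H) ?P"]) (auto simp: CCG_def inv_into_f_f[OF inj])
  qed
  ultimately show ?thesis using r(1) unfolding defining_graphs_def by blast
qed

section \<open>An executable test for connected dominating sets\<close>

definition nbr_list_graph :: "nat list list \<Rightarrow> nat pair_pre_digraph" where
  "nbr_list_graph ns =
     \<lparr>pverts = {0..<length ns}, parcs = {(u, v). u < length ns \<and> v \<in> set (ns ! u)}\<rparr>"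

text \<open>The set \<open>R\<close> is updated during the pass, so one sweep follows any path whose
  vertices occur in the order of the list.\<close>

definition sweep :: "nat list list \<Rightarrow> nat list \<Rightarrow> nat list \<Rightarrow> nat list" where
  "sweep ns = fold (\<lambda>v R. if v \<in> set R \<or> (\<forall>u\<in>set (ns ! v). u \<notin> set R) then R else v # R)"

text \<open>The search starts at \<open>hd S\<close>; both predicates below treat the empty list
  separately. Four sweeps are enough for the graphs evaluated here.\<close>

definition component :: "nat list list \<Rightarrow> nat list \<Rightarrow> nat list" where
  "component ns S = sweep ns S (sweep ns S (sweep ns S (sweep ns S [hd S])))"

text \<open>
  A fixed number of sweeps need not exhaust the component, so neither predicate is the negation
  of the other: \<open>no_cds\<close> checks that the set that was found is closed under adjacency.
\<close>

definition is_cds :: "nat list list \<Rightarrow> nat list \<Rightarrow> bool" where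
  "is_cds ns S \<longleftrightarrow> S \<noteq> [] \<and>
     (\<forall>v\<in>set [0..<length ns]. v \<in> set S \<or> (\<exists>u\<in>set (ns ! v). u \<in> set S)) \<and>
     (let R = component ns S in \<forall>v\<in>set S. v \<in> set R)"

definition no_cds :: "nat list list \<Rightarrow> nat list \<Rightarrow> bool" where
  "no_cds ns S \<longleftrightarrow> S = [] \<or>
     (\<exists>v\<in>set [0..<length ns]. v \<notin> set S \<and> (\<forall>u\<in>set (ns ! v). u \<notin> set S)) \<or>
     (let R = component ns S in
        (\<forall>v\<in>set R. \<forall>u\<in>set (ns ! v). u \<in> set S \<longrightarrow> u \<in> set R) \<and> (\<exists>v\<in>set S. v \<notin> set R))"

text \<open>Both soundness proofs see the search only through an invariant that survives adding a
  vertex of \<open>S\<close> with a neighbour in \<open>R\<close>; exhaustiveness of the search is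
  never claimed.\<close>

lemma sweep_invariant:
  assumes "\<And>v u R. v \<in> set S \<Longrightarrow> u \<in> set (ns ! v) \<Longrightarrow> u \<in> set R \<Longrightarrow> I R \<Longrightarrow> I (v # R)" "I R"
  shows "I (sweep ns S R)"
proof -
  have "set T \<subseteq> set S \<Longrightarrow> I R \<Longrightarrow> I (sweep ns T R)" for T
  proof (induct T arbitrary: R)
    case Nil
    then show ?case by (simp add: sweep_def)
  next
    case (Cons v T)
    let ?R = "if v \<in> set R \<or> (\<forall>u\<in>set (ns ! v). u \<notin> set R) then R else v # R"
    have "I ?R" using assms(1)[of v _ R] Cons.prems by (auto split: if_splits)
    then have "I (sweep ns T ?R)" using Cons by simp
    then show ?case by (simp only: sweep_def fold_Cons o_apply)
  qed
  then show ?thesis using assms(2) by simp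
qed

lemma component_invariant:
  assumes "\<And>v u R. v \<in> set S \<Longrightarrow> u \<in> set (ns ! v) \<Longrightarrow> u \<in> set R \<Longrightarrow> I R \<Longrightarrow> I (v # R)" "I [hd S]"
  shows "I (component ns S)"
proof -
  note step = sweep_invariant[where I = I, OF assms(1)]
  show ?thesis unfolding component_def by (intro step assms(2))
qed

context
  fixes ns :: "nat list list" and S :: "nat list"
  assumes sym: "sym (parcs (nbr_list_graph ns))" and S: "set S \<subseteq> {0..<length ns}"
begin

lemma connected_dominating_set_nbr_list_graph:
  "connected_dominating_set (nbr_list_graph ns) (set S) \<longleftrightarrow>
    (\<forall>v<length ns. v \<notin> set S \<longrightarrow> (\<exists>u\<in>set (ns ! v). u \<in> set S)) \<and>
    conn (parcs (nbr_list_graph ns)) (set S)"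
  using S unfolding connected_dominating_set_iff[OF sym]
  by (auto simp: nbr_list_graph_def Ball_def Bex_def)

text \<open>Invariant: whatever has been found is joined to \<open>hd S\<close> within
  \<open>S\<close>. The test itself confirms that all of \<open>S\<close> has been found.\<close>

lemma is_cds_sound:
  assumes "is_cds ns S"
  shows "connected_dominating_set (nbr_list_graph ns) (set S)"
proof -
  let ?Q = "parcs (nbr_list_graph ns) \<inter> set S \<times> set S"
  have ne: "S \<noteq> []" and all: "\<forall>v\<in>set S. v \<in> set (component ns S)"
    using assms by (auto simp: is_cds_def Let_def)
  have "set (component ns S) \<subseteq> {v \<in> set S. (v, hd S) \<in> ?Q\<^sup>*}"
  proof (rule component_invariant)
    fix v u R assume v: "v \<in> set S" "u \<in> set (ns ! v)" "u \<in> set R"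
      and R: "set R \<subseteq> {v \<in> set S. (v, hd S) \<in> ?Q\<^sup>*}"
    then have "(v, u) \<in> ?Q" "(u, hd S) \<in> ?Q\<^sup>*" using S by (auto simp: nbr_list_graph_def)
    then have "(v, hd S) \<in> ?Q\<^sup>*" by (rule converse_rtrancl_into_rtrancl)
    then show "set (v # R) \<subseteq> {v \<in> set S. (v, hd S) \<in> ?Q\<^sup>*}" using v R by auto
  qed (use ne in auto)
  then have to: "(v, hd S) \<in> ?Q\<^sup>*" if "v \<in> set S" for v using all that by auto
  have "sym ?Q" using sym by (auto simp: sym_def)
  then have "sym (?Q\<^sup>*)" by (rule sym_rtrancl)
  then have "conn (parcs (nbr_list_graph ns)) (set S)"
    unfolding conn_def
  proof (intro conjI ballI)
    fix u v assume "u \<in> set S" "v \<in> set S"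
    then show "(u, v) \<in> ?Q\<^sup>*"
      using to[of u] to[of v] \<open>sym (?Q\<^sup>*)\<close> by (meson rtrancl_trans symD)
  qed (use ne in simp)
  then show ?thesis
    using assms by (auto simp: connected_dominating_set_nbr_list_graph is_cds_def)
qed

text \<open>In the last alternative the set found is a nonempty proper part of \<open>S\<close> that
  no arc leaves within \<open>S\<close>, against \<open>conn_exit\<close>.\<close>

lemma no_cds_sound:
  assumes "no_cds ns S"
  shows "\<not> connected_dominating_set (nbr_list_graph ns) (set S)"
proof
  assume cds: "connected_dominating_set (nbr_list_graph ns) (set S)"
  then have "S \<noteq> []" by (auto simp: connected_dominating_set_nbr_list_graph conn_def)
  let ?R = "component ns S"
  have "set ?R \<subseteq> set S \<and> hd S \<in> set ?R"
    using \<open>S \<noteq> []\<close>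
    by (intro component_invariant[where I = "\<lambda>R. set R \<subseteq> set S \<and> hd S \<in> set R"]) auto
  moreover have closed: "\<forall>v\<in>set ?R. \<forall>u\<in>set (ns ! v). u \<in> set S \<longrightarrow> u \<in> set ?R"
    and "set ?R \<noteq> set S"
  proof -
    have "\<not> (\<exists>v\<in>set [0..<length ns]. v \<notin> set S \<and> (\<forall>u\<in>set (ns ! v). u \<notin> set S))"
      using cds by (auto simp: connected_dominating_set_nbr_list_graph)
    then have "(\<forall>v\<in>set ?R. \<forall>u\<in>set (ns ! v). u \<in> set S \<longrightarrow> u \<in> set ?R) \<and> (\<exists>v\<in>set S. v \<notin> set ?R)"
      using assms \<open>S \<noteq> []\<close> unfolding no_cds_def Let_def by blast
    then show "\<forall>v\<in>set ?R. \<forall>u\<in>set (ns ! v). u \<in> set S \<longrightarrow> u \<in> set ?R" "set ?R \<noteq> set S"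
      by blast+
  qed
  moreover have "conn (parcs (nbr_list_graph ns)) (set S)"
    using cds by (simp add: connected_dominating_set_nbr_list_graph)
  ultimately obtain u v where "u \<in> set ?R" "v \<in> set S - set ?R" "(u, v) \<in> parcs (nbr_list_graph ns)"
    using conn_exit by (metis empty_iff)
  then show False using closed by (auto simp: nbr_list_graph_def)
qed

end

text \<open>Only pairs with \<open>h' < h\<close> are evaluated, since unions and
  \<open>edge\<close> are symmetric. A non-edge is certified by \<open>no_cds\<close> instead of by
  failure of \<open>is_cds\<close>.\<close>

definition check_realizes :: "nat list list \<Rightarrow> nat list \<Rightarrow> nat \<Rightarrow> (nat \<times> nat) list \<Rightarrow> bool" where
  "check_realizes ns cs k es \<longleftrightarrow>
     length cs = length ns \<and> (\<forall>c\<in>set cs. c < k) \<and> (\<forall>h\<in>set [0..<k]. h \<in> set cs) \<and>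
     (\<forall>u\<in>set [0..<length ns]. length (ns ! u) \<le> 3 \<and>
        (\<forall>v\<in>set (ns ! u). v < length ns \<and> v \<noteq> u \<and> u \<in> set (ns ! v))) \<and>
     is_cds ns [0..<length ns] \<and>
     (let cl = (\<lambda>h. filter (\<lambda>v. cs ! v = h) [0..<length ns]);
          edge = (\<lambda>h h'. (h, h') \<in> set es \<or> (h', h) \<in> set es) in
      \<forall>h\<in>set [0..<k]. no_cds ns (cl h) \<and> (\<exists>h'\<in>set [0..<k]. edge h h') \<and>
        (\<forall>h'\<in>set [0..<h]. if edge h h' then is_cds ns (cl h @ cl h') else no_cds ns (cl h @ cl h')))"

lemma realizes_if_check_realizes:
  assumes "check_realizes ns cs k es"
  shows "realizes (nbr_list_graph ns) ((!) cs) (graph_of_edges k (set es))"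
proof -
  let ?G = "nbr_list_graph ns"
  define cl where "cl h = filter (\<lambda>v. cs ! v = h) [0..<length ns]" for h
  define edge where "edge h h' \<longleftrightarrow> (h, h') \<in> set es \<or> (h', h) \<in> set es" for h h'
  have chk: "length cs = length ns \<and> (\<forall>c\<in>set cs. c < k) \<and> (\<forall>h\<in>set [0..<k]. h \<in> set cs) \<and>
     (\<forall>u\<in>set [0..<length ns]. length (ns ! u) \<le> 3 \<and>
        (\<forall>v\<in>set (ns ! u). v < length ns \<and> v \<noteq> u \<and> u \<in> set (ns ! v))) \<and>
     is_cds ns [0..<length ns] \<and>
     (\<forall>h\<in>set [0..<k]. no_cds ns (cl h) \<and> (\<exists>h'\<in>set [0..<k]. edge h h') \<and>
        (\<forall>h'\<in>set [0..<h]. if edge h h' then is_cds ns (cl h @ cl h') else no_cds ns (cl h @ cl h')))"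
    using assms unfolding check_realizes_def Let_def cl_def edge_def .
  note chk_cs = chk[THEN conjunct1] chk[THEN conjunct2, THEN conjunct1]
    chk[THEN conjunct2, THEN conjunct2, THEN conjunct1]
  note chk' = chk[THEN conjunct2, THEN conjunct2, THEN conjunct2]
  have cs: "length cs = length ns" "\<forall>c\<in>set cs. c < k" "\<forall>h<k. h \<in> set cs"
    using chk_cs by auto
  have nbrs: "length (ns ! u) \<le> 3 \<and> (\<forall>v\<in>set (ns ! u). v < length ns \<and> v \<noteq> u \<and> u \<in> set (ns ! v))"
    if "u < length ns" for u
    by (rule bspec[OF chk'[THEN conjunct1]]) (use that in simp)
  note deg = nbrs[THEN conjunct1]
  have nbr: "v < length ns \<and> v \<noteq> u \<and> u \<in> set (ns ! v)" if "u < length ns" "v \<in> set (ns ! u)" for u v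
    using nbrs[OF that(1)] that(2) by blast
  note cds_all = chk'[THEN conjunct2, THEN conjunct1]
  have colours: "no_cds ns (cl h) \<and> (\<exists>h'\<in>set [0..<k]. edge h h') \<and>
      (\<forall>h'\<in>set [0..<h]. if edge h h' then is_cds ns (cl h @ cl h') else no_cds ns (cl h @ cl h'))"
    if "h < k" for h
    by (rule bspec[OF chk'[THEN conjunct2, THEN conjunct2]]) (use that in simp)
  note no_cds_single = colours[THEN conjunct1]
  have partner: "\<exists>h'<k. edge h h'" if "h < k" for h
    using colours[OF that, THEN conjunct2, THEN conjunct1] by auto
  have pair: "if edge h h' then is_cds ns (cl h @ cl h') else no_cds ns (cl h @ cl h')"
    if "h < k" "h' < h" for h h'
    by (rule bspec[OF colours[OF that(1), THEN conjunct2, THEN conjunct2]]) (use that in simp)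
  have sym: "sym (parcs ?G)"
  proof (rule symI)
    fix u v assume "(u, v) \<in> parcs ?G"
    then have "u < length ns" "v \<in> set (ns ! u)" by (simp_all add: nbr_list_graph_def)
    from nbr[OF this] show "(v, u) \<in> parcs ?G" by (simp add: nbr_list_graph_def)
  qed
  have cc: "colour_class ?G ((!) cs) h = set (cl h)" for h
    by (auto simp: colour_class_def cl_def nbr_list_graph_def)
  have sub: "set (cl h) \<subseteq> {0..<length ns}" for h by (auto simp: cl_def)
  have "card (parcs ?G `` {v}) \<le> 3" if "v < length ns" for v
  proof -
    have "parcs ?G `` {v} = set (ns ! v)" using that by (auto simp: nbr_list_graph_def)
    then show ?thesis using deg[OF that] card_length[of "ns ! v"] by simp
  qed
  moreover have pv: "pverts ?G = {0..<length ns}" by (simp add: nbr_list_graph_def)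
  moreover have "conn (parcs ?G) (pverts ?G)"
    using is_cds_sound[OF sym, of "[0..<length ns]"] cds_all pv
    by (simp add: connected_dominating_set_iff[OF sym])
  moreover have "parcs ?G \<subseteq> pverts ?G \<times> pverts ?G" "irrefl (parcs ?G)"
  proof -
    have "(u, v) \<in> pverts ?G \<times> pverts ?G \<and> u \<noteq> v" if "(u, v) \<in> parcs ?G" for u v
    proof -
      have "u < length ns" "v \<in> set (ns ! u)" using that by (simp_all add: nbr_list_graph_def)
      from nbr[OF this] this show ?thesis by (simp add: pv)
    qed
    then show "parcs ?G \<subseteq> pverts ?G \<times> pverts ?G" "irrefl (parcs ?G)"
      unfolding irrefl_def by (simp_all only: subset_iff split_paired_All, blast+)
  qed
  ultimately have "subcubic ?G"
    unfolding subcubic_iff using sym by simp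
  have img: "(!) cs ` pverts ?G = {0..<k}"
  proof -
    have "set cs = {0..<k}" using cs(2,3) unfolding atLeast0LessThan lessThan_def by blast
    then show ?thesis unfolding pv using nth_image[of "length cs" cs] cs(1) by simp
  qed
  have lt: "connected_dominating_set ?G (set (cl h) \<union> set (cl h')) \<longleftrightarrow> edge h h'"
    if "h < k" "h' < h" for h h'
  proof -
    have "set (cl h @ cl h') \<subseteq> {0..<length ns}" using sub by simp
    note s = is_cds_sound[OF sym this] no_cds_sound[OF sym this]
    show ?thesis using pair[OF that] s by (cases "edge h h'") simp_all
  qed
  have ne: "connected_dominating_set ?G (set (cl h) \<union> set (cl h')) \<longleftrightarrow> edge h h'"
    if "h < k" "h' < k" "h \<noteq> h'" for h h'
  proof (cases "h' < h")
    case True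
    then show ?thesis using lt that by simp
  next
    case False
    then show ?thesis using lt[of h' h] that by (auto simp: Un_commute edge_def)
  qed
  have arcs: "(h, h') \<in> parcs (graph_of_edges k (set es)) \<longleftrightarrow> edge h h'" for h h'
    by (auto simp: edge_def)
  show ?thesis
    unfolding realizes_def cc pverts_graph_of_edges
  proof (intro conjI ballI impI)
    fix h assume "h \<in> {0..<k}"
    then have h: "h < k" by simp
    show "\<not> connected_dominating_set ?G (set (cl h))"
      by (rule no_cds_sound[OF sym sub no_cds_single[OF h]])
    show "\<exists>h'\<in>{0..<k}. (h, h') \<in> parcs (graph_of_edges k (set es))"
      using partner[OF h] unfolding arcs by auto
    show "(h, h') \<in> parcs (graph_of_edges k (set es)) \<longleftrightarrow>
        connected_dominating_set ?G (set (cl h) \<union> set (cl h'))" if "h' \<in> {0..<k}" "h \<noteq> h'" for h'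
      using ne[OF h] that unfolding arcs by simp
  qed fact+
qed

section \<open>Inserting rungs\<close>

text \<open>The rails are \<open>a1 a2\<close> and \<open>b1 b2\<close>, the rungs
  \<open>a1 b1\<close> and \<open>a2 b2\<close>; the new rung \<open>a b\<close> subdivides both
  rails.\<close>

locale rung_insertion =
  fixes G :: "'a pair_pre_digraph" and a1 a2 b1 b2 a b :: 'a
  assumes sub: "subcubic G"
    and arcs: "(a1, a2) \<in> parcs G" "(b1, b2) \<in> parcs G" "(a1, b1) \<in> parcs G" "(a2, b2) \<in> parcs G"
    and distinct: "{a1, a2} \<inter> {b1, b2} = {}"
    and fresh: "a \<notin> pverts G" "b \<notin> pverts G" "a \<noteq> b"
begin

definition new_arcs :: "'a rel" where
  "new_arcs = {(a1, a), (a, a2), (b1, b), (b, b2), (a, b)}"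

definition old_arcs :: "'a rel" where
  "old_arcs = {(a1, a2), (b1, b2)}"

definition G' :: "'a pair_pre_digraph" where
  "G' = \<lparr>pverts = insert a (insert b (pverts G)),
     parcs = (parcs G - (old_arcs \<union> old_arcs\<inverse>)) \<union> (new_arcs \<union> new_arcs\<inverse>)\<rparr>"

text \<open>What a union of classes becomes: a new vertex joins the class of the ends of its rail.
  Since these ends share a colour, testing one of them is enough, and \<open>ext\<close> commutes
  with unions.\<close>

definition ext :: "'a set \<Rightarrow> 'a set" where
  "ext S = S \<union> (if a1 \<in> S then {a} else {}) \<union> (if b1 \<in> S then {b} else {})"

lemma G_facts: "finite (pverts G)" "parcs G \<subseteq> pverts G \<times> pverts G" "sym (parcs G)"
  "irrefl (parcs G)" "conn (parcs G) (pverts G)" "v \<in> pverts G \<Longrightarrow> card (parcs G `` {v}) \<le> 3"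
  using sub by (auto simp: subcubic_iff)

lemma finite_nbrs: "finite (parcs G `` {v})"
  using G_facts(1,2) by (meson finite_Image finite_SigmaI finite_subset)

lemma verts: "a1 \<in> pverts G" "a2 \<in> pverts G" "b1 \<in> pverts G" "b2 \<in> pverts G"
  using G_facts(2) arcs by auto

lemma neqs: "a1 \<noteq> a2" "b1 \<noteq> b2" "a1 \<noteq> b1" "a1 \<noteq> b2" "a2 \<noteq> b1" "a2 \<noteq> b2"
  using G_facts(4) arcs distinct by (auto simp: irrefl_def)

lemma neqs_fresh: "v \<in> pverts G \<Longrightarrow> v \<noteq> a" "v \<in> pverts G \<Longrightarrow> v \<noteq> b"
  using fresh by auto

lemma sym_G': "sym (parcs G')"
  using G_facts(3) unfolding G'_def sym_def by simp

lemma old_in_G': "(u, v) \<in> parcs G \<Longrightarrow> (u, v) \<notin> old_arcs \<union> old_arcs\<inverse> \<Longrightarrow> (u, v) \<in> parcs G'"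
  by (simp add: G'_def)

lemma path_in_G': "(a1, a) \<in> parcs G'" "(a, a2) \<in> parcs G'" "(b1, b) \<in> parcs G'"
  "(b, b2) \<in> parcs G'" "(a, b) \<in> parcs G'" "(b, a) \<in> parcs G'"
  by (simp_all add: G'_def new_arcs_def)

lemma rungs_in_G': "(a1, b1) \<in> parcs G'" "(a2, b2) \<in> parcs G'"
  using arcs neqs by (auto simp: G'_def old_arcs_def)

lemma G'_cases:
  assumes "(u, v) \<in> parcs G'"
  obtains "(u, v) \<in> parcs G" "(u, v) \<notin> old_arcs \<union> old_arcs\<inverse>"
    | "(u, v) \<in> new_arcs" | "(v, u) \<in> new_arcs"
  using assms by (auto simp: G'_def)

context
  fixes S
  assumes S: "S \<subseteq> pverts G" and rail: "a1 \<in> S \<longleftrightarrow> a2 \<in> S" "b1 \<in> S \<longleftrightarrow> b2 \<in> S"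
begin

lemma mem_ext: "a \<in> ext S \<longleftrightarrow> a1 \<in> S" "b \<in> ext S \<longleftrightarrow> b1 \<in> S"
  "v \<in> pverts G \<Longrightarrow> v \<in> ext S \<longleftrightarrow> v \<in> S"
  using S fresh by (auto simp: ext_def)

text \<open>
  Contracting the edges \<open>a1 a\<close> and \<open>b1 b\<close> turns the graph after the insertion back into \<open>G\<close>.
\<close>

lemma conn_ext_iff: "conn (parcs G') (ext S) \<longleftrightarrow> conn (parcs G) S"
proof
  assume con: "conn (parcs G') (ext S)"
  define f where "f x = (if x = a then a1 else if x = b then b1 else x)" for x
  let ?Q = "parcs G \<inter> S \<times> S"
  have symQ: "sym ?Q" using G_facts(3) by (auto simp: sym_def)
  have new: "(f u, f v) \<in> ?Q \<or> f u = f v" if "(u, v) \<in> new_arcs" "u \<in> ext S" "v \<in> ext S" for u v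
    using that neqs_fresh verts fresh(3) arcs mem_ext rail
    unfolding new_arcs_def f_def by (elim insertE emptyE Pair_inject; hypsubst; simp)
  show "conn (parcs G) S"
  proof (rule conn_map[OF con, of f])
    have into: "f x \<in> S" if "x \<in> ext S" for x
      using that S fresh by (auto simp: f_def ext_def split: if_splits)
    have onto: "x = f x" "x \<in> ext S" if "x \<in> S" for x
      using that S fresh by (auto simp: f_def ext_def)
    show "f ` ext S = S"
    proof
      show "f ` ext S \<subseteq> S" using into by (rule image_subsetI)
      show "S \<subseteq> f ` ext S"
      proof
        fix x assume "x \<in> S"
        then show "x \<in> f ` ext S" using onto by (intro image_eqI)
      qed
    qed
    fix u v assume uv: "(u, v) \<in> parcs G'" "u \<in> ext S" "v \<in> ext S"
    from uv(1) show "(f u, f v) \<in> ?Q\<^sup>*"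
    proof (cases rule: G'_cases)
      case 1
      then have "u \<in> pverts G" "v \<in> pverts G" using G_facts(2) by auto
      then have "(f u, f v) \<in> ?Q" using 1 uv mem_ext(3) neqs_fresh by (simp add: f_def)
      then show ?thesis by blast
    next
      case 2
      then have "(f u, f v) \<in> ?Q \<or> f u = f v" using uv(2,3) by (rule new)
      then show ?thesis by auto
    next
      case 3
      then have "(f v, f u) \<in> ?Q \<or> f v = f u" using uv(3,2) by (rule new)
      then show ?thesis using symQ by (auto dest: symD)
    qed
  qed
next
  assume con: "conn (parcs G) S"
  let ?Q = "parcs G' \<inter> ext S \<times> ext S"
  have "sym ?Q" using sym_G' by (auto simp: sym_def)
  then have symQ: "sym (?Q\<^sup>*)" by (rule sym_rtrancl)
  have ina: "a1 \<in> S \<Longrightarrow> a1 \<in> ext S \<and> a \<in> ext S \<and> a2 \<in> ext S"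
    and inb: "b1 \<in> S \<Longrightarrow> b1 \<in> ext S \<and> b \<in> ext S \<and> b2 \<in> ext S"
    using rail by (auto simp: ext_def)
  have old: "(u, v) \<in> ?Q\<^sup>*" if uv: "(u, v) \<in> old_arcs" "u \<in> S" "v \<in> S" for u v
  proof -
    consider "u = a1" "v = a2" | "u = b1" "v = b2" using uv(1) by (auto simp: old_arcs_def)
    then show ?thesis
    proof cases
      case 1
      have "(a1, a) \<in> ?Q" "(a, a2) \<in> ?Q"
        using ina 1 uv(2) path_in_G' by auto
      with 1 show ?thesis by (meson converse_rtrancl_into_rtrancl r_into_rtrancl)
    next
      case 2
      have "(b1, b) \<in> ?Q" "(b, b2) \<in> ?Q"
        using inb 2 uv(2) path_in_G' by auto
      with 2 show ?thesis by (meson converse_rtrancl_into_rtrancl r_into_rtrancl)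
    qed
  qed
  show "conn (parcs G') (ext S)"
  proof (rule conn_extend[OF con sym_G'])
    show "S \<subseteq> ext S" by (auto simp: ext_def)
    show "(u, v) \<in> ?Q\<^sup>*" if uv: "(u, v) \<in> parcs G" "u \<in> S" "v \<in> S" for u v
    proof -
      consider "(u, v) \<in> old_arcs" | "(v, u) \<in> old_arcs" | "(u, v) \<in> parcs G'"
        using old_in_G'[OF uv(1)] by (metis Un_iff converseD)
      then show ?thesis
      proof cases
        case 1
        then show ?thesis using uv(2,3) by (rule old)
      next
        case 2
        then have "(v, u) \<in> ?Q\<^sup>*" using uv(3,2) by (rule old)
        with symQ show ?thesis by (rule symD)
      next
        case 3
        then have "(u, v) \<in> ?Q" using uv(2,3) \<open>S \<subseteq> ext S\<close> by auto
        then show ?thesis by (rule r_into_rtrancl)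
      qed
    qed
    show "\<exists>y\<in>S. (x, y) \<in> ?Q\<^sup>*" if "x \<in> ext S" for x
    proof -
      have "(a, a2) \<in> ?Q\<^sup>*" if "a1 \<in> S"
        using ina[OF that] path_in_G' by (intro r_into_rtrancl) simp
      moreover have "(b, b2) \<in> ?Q\<^sup>*" if "b1 \<in> S"
        using inb[OF that] path_in_G' by (intro r_into_rtrancl) simp
      moreover have "x \<in> S \<or> x = a \<and> a1 \<in> S \<or> x = b \<and> b1 \<in> S"
        using that by (auto simp: ext_def split: if_splits)
      ultimately show ?thesis using rail by (metis rtrancl.rtrancl_refl)
    qed
  qed
qed

text \<open>If \<open>S\<close> misses one rail it contains the other, so the ends of the missed
  rail and the new vertex on it are dominated across the three rungs. Every other old vertex keeps
  its neighbours.\<close>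

lemma cds_ext_iff:
  assumes "a1 \<in> S \<or> b1 \<in> S"
  shows "connected_dominating_set G' (ext S) \<longleftrightarrow> connected_dominating_set G S"
proof -
  have "ext S \<subseteq> pverts G'" using S by (auto simp: ext_def G'_def)
  moreover have "(\<forall>v\<in>pverts G' - ext S. \<exists>u\<in>ext S. (v, u) \<in> parcs G') \<longleftrightarrow>
      (\<forall>v\<in>pverts G - S. \<exists>u\<in>S. (v, u) \<in> parcs G)"
  proof -
    have dom: "(\<exists>u\<in>ext S. (v, u) \<in> parcs G') \<longleftrightarrow> (\<exists>u\<in>S. (v, u) \<in> parcs G)"
      if v: "v \<in> pverts G - S" for v
    proof (cases "v \<in> {a1, a2, b1, b2}")
      case True
      then consider "v = a1" "b1 \<in> S" | "v = a2" "b2 \<in> S" | "v = b1" "a1 \<in> S" | "v = b2" "a2 \<in> S"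
        using assms rail v by auto
      then have "\<exists>u\<in>S. (v, u) \<in> parcs G \<and> (v, u) \<in> parcs G'"
        using arcs rungs_in_G' symD[OF G_facts(3)] symD[OF sym_G'] by cases blast+
      moreover have "S \<subseteq> ext S" by (auto simp: ext_def)
      ultimately show ?thesis by blast
    next
      case False
      then have "(v, u) \<in> parcs G' \<longleftrightarrow> (v, u) \<in> parcs G" for u
        using v neqs_fresh by (auto simp: G'_def new_arcs_def old_arcs_def)
      moreover have "(v, u) \<in> parcs G \<Longrightarrow> u \<in> ext S \<longleftrightarrow> u \<in> S" for u
        using G_facts(2) mem_ext(3) by auto
      ultimately show ?thesis using mem_ext(3) S by blast
    qed
    have dom_new: "\<exists>u\<in>ext S. (v, u) \<in> parcs G'" if "v = a \<or> v = b" "v \<notin> ext S" for v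
    proof -
      have "v = a \<and> b1 \<in> S \<or> v = b \<and> a1 \<in> S" using that assms mem_ext by auto
      then have "v = a \<and> b \<in> ext S \<or> v = b \<and> a \<in> ext S" using mem_ext by blast
      then show ?thesis using path_in_G'(5,6) by blast
    qed
    have rest: "v \<in> pverts G' - ext S \<longleftrightarrow> v \<in> pverts G - S \<or> (v = a \<or> v = b) \<and> v \<notin> ext S" for v
      using mem_ext fresh S by (auto simp: G'_def)
    show ?thesis
    proof (intro iffI ballI)
      fix v assume all: "\<forall>v\<in>pverts G' - ext S. \<exists>u\<in>ext S. (v, u) \<in> parcs G'" and v: "v \<in> pverts G - S"
      from v have "v \<in> pverts G' - ext S" unfolding rest by (rule disjI1)
      with all have "\<exists>u\<in>ext S. (v, u) \<in> parcs G'" by (rule bspec)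
      then show "\<exists>u\<in>S. (v, u) \<in> parcs G" unfolding dom[OF v] .
    next
      fix v assume all: "\<forall>v\<in>pverts G - S. \<exists>u\<in>S. (v, u) \<in> parcs G" and v: "v \<in> pverts G' - ext S"
      from v[unfolded rest] show "\<exists>u\<in>ext S. (v, u) \<in> parcs G'"
      proof
        assume v: "v \<in> pverts G - S"
        with all have "\<exists>u\<in>S. (v, u) \<in> parcs G" by (rule bspec)
        then show ?thesis unfolding dom[OF v] .
      qed (use dom_new in blast)
    qed
  qed
  ultimately show ?thesis
    using S conn_ext_iff
    by (simp add: connected_dominating_set_iff[OF sym_G'] connected_dominating_set_iff[OF G_facts(3)])
qed

lemma not_cds_ext:
  assumes "a1 \<notin> S" "b1 \<notin> S"
  shows "\<not> connected_dominating_set G' (ext S)"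
proof
  assume "connected_dominating_set G' (ext S)"
  moreover have "a \<in> pverts G' - ext S" using mem_ext assms by (simp add: G'_def)
  ultimately obtain u where u: "u \<in> ext S" "(a, u) \<in> parcs G'"
    unfolding connected_dominating_set_iff[OF sym_G'] by blast
  have "(a, u) \<notin> parcs G" using G_facts(2) fresh by auto
  then have "u \<in> {a1, a2, b}"
    using u(2) fresh verts by (auto simp: G'_def new_arcs_def)
  then show False using u(1) assms rail mem_ext verts by auto
qed

end

lemma subcubic_G': "subcubic G'"
  unfolding subcubic_iff
proof (intro conjI ballI)
  show "finite (pverts G')" using G_facts(1) by (simp add: G'_def)
  show "parcs G' \<subseteq> pverts G' \<times> pverts G'"
    using G_facts(2) verts by (auto simp: G'_def new_arcs_def)
  show "sym (parcs G')" by (rule sym_G')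
  show "irrefl (parcs G')"
    using G_facts(4) fresh verts by (auto simp: G'_def new_arcs_def irrefl_def)
  have "ext (pverts G) = pverts G'" using verts by (auto simp: ext_def G'_def)
  then show "conn (parcs G') (pverts G')"
    using conn_ext_iff[of "pverts G"] G_facts(5) verts by simp
  fix v assume "v \<in> pverts G'"
  \<comment> \<open>The end of a rail exchanges its neighbour on the rail for the new vertex, so its
    degree does not grow.\<close>
  have swap: "card (insert x (N - {y})) \<le> 3" if "card N \<le> 3" "y \<in> N" "finite N" for x y and N :: "'a set"
    using that card_insert_le_m1[of 3 "N - {y}" x] by simp
  have nb: "card (parcs G' `` {v}) \<le> 3"
    if "v \<in> pverts G" "(v, y) \<in> parcs G" "parcs G' `` {v} \<subseteq> insert x (parcs G `` {v} - {y})" for v x y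
    using swap[OF G_facts(6)[OF that(1)], of y x] that(2) finite_nbrs[of v]
      card_mono[OF _ that(3)] by force
  have arcs': "(a2, a1) \<in> parcs G" "(b2, b1) \<in> parcs G" using arcs G_facts(3) by (auto dest: symD)
  consider "v = a" | "v = b" | "v = a1" | "v = a2" | "v = b1" | "v = b2"
    | "v \<in> pverts G" "v \<notin> {a1, a2, b1, b2}" using \<open>v \<in> pverts G'\<close> by (auto simp: G'_def)
  then show "card (parcs G' `` {v}) \<le> 3"
  proof cases
    case 1
    have "parcs G' `` {a} \<subseteq> {a1, a2, b}"
      using G_facts(2) fresh verts by (auto simp: G'_def new_arcs_def)
    then have "card (parcs G' `` {a}) \<le> card {a1, a2, b}" by (intro card_mono) auto
    with 1 show ?thesis using card_length[of "[a1, a2, b]"] by simp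
  next
    case 2
    have "parcs G' `` {b} \<subseteq> {b1, b2, a}"
      using G_facts(2) fresh verts by (auto simp: G'_def new_arcs_def)
    then have "card (parcs G' `` {b}) \<le> card {b1, b2, a}" by (intro card_mono) auto
    with 2 show ?thesis using card_length[of "[b1, b2, a]"] by simp
  next
    case 3
    show ?thesis unfolding 3 using neqs neqs_fresh verts
      by (intro nb[OF verts(1) arcs(1), of a]) (auto simp: G'_def new_arcs_def old_arcs_def)
  next
    case 4
    show ?thesis unfolding 4 using neqs neqs_fresh verts
      by (intro nb[OF verts(2) arcs'(1), of a]) (auto simp: G'_def new_arcs_def old_arcs_def)
  next
    case 5
    show ?thesis unfolding 5 using neqs neqs_fresh verts
      by (intro nb[OF verts(3) arcs(2), of b]) (auto simp: G'_def new_arcs_def old_arcs_def)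
  next
    case 6
    show ?thesis unfolding 6 using neqs neqs_fresh verts
      by (intro nb[OF verts(4) arcs'(2), of b]) (auto simp: G'_def new_arcs_def old_arcs_def)
  next
    case 7
    then have "parcs G' `` {v} \<subseteq> parcs G `` {v}"
      using neqs_fresh by (auto simp: G'_def new_arcs_def)
    then show ?thesis using card_mono[OF finite_nbrs] G_facts(6)[OF 7(1)] le_trans by blast
  qed
qed

end

text \<open>The last condition says that the two colours of the rails cover the edges of
  \<open>H\<close>: the unions that stop dominating by \<open>not_cds_ext\<close> are then never
  edges.\<close>

definition ladder :: "'a pair_pre_digraph \<Rightarrow> ('a \<Rightarrow> 'b) \<Rightarrow> 'b pair_pre_digraph \<Rightarrow>
    'a \<Rightarrow> 'a \<Rightarrow> 'a \<Rightarrow> 'a \<Rightarrow> bool" where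
  "ladder G c H a1 a2 b1 b2 \<longleftrightarrow> realizes G c H \<and>
     (a1, a2) \<in> parcs G \<and> (b1, b2) \<in> parcs G \<and> (a1, b1) \<in> parcs G \<and> (a2, b2) \<in> parcs G \<and>
     c a1 = c a2 \<and> c b1 = c b2 \<and> c a1 \<noteq> c b1 \<and>
     (\<forall>h h'. (h, h') \<in> parcs H \<longrightarrow> c a1 \<in> {h, h'} \<or> c b1 \<in> {h, h'})"

text \<open>The insertion creates the 4-cycle \<open>a1 a b b1\<close> in the same two colours,
  which is what allows the next insertion.\<close>

lemma ladder_insert_rung:
  assumes "ladder G c H a1 a2 b1 b2" "a \<notin> pverts G" "b \<notin> pverts G" "a \<noteq> b"
  shows "\<exists>G'. pverts G' = insert a (insert b (pverts G)) \<and>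
    ladder G' (c(a := c a1, b := c b1)) H a1 a b1 b"
proof -
  have l: "realizes G c H" "(a1, a2) \<in> parcs G" "(b1, b2) \<in> parcs G" "(a1, b1) \<in> parcs G"
    "(a2, b2) \<in> parcs G" "c a1 = c a2" "c b1 = c b2" "c a1 \<noteq> c b1"
    and cover: "\<And>h h'. (h, h') \<in> parcs H \<Longrightarrow> c a1 \<in> {h, h'} \<or> c b1 \<in> {h, h'}"
    using assms(1) unfolding ladder_def by blast+
  have r: "subcubic G" "c ` pverts G = pverts H"
    "\<And>h. h \<in> pverts H \<Longrightarrow> \<not> connected_dominating_set G (colour_class G c h)"
    "\<And>h. h \<in> pverts H \<Longrightarrow> \<exists>h'\<in>pverts H. (h, h') \<in> parcs H"
    "\<And>h h'. h \<in> pverts H \<Longrightarrow> h' \<in> pverts H \<Longrightarrow> h \<noteq> h' \<Longrightarrow>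
        (h, h') \<in> parcs H \<longleftrightarrow>
          connected_dominating_set G (colour_class G c h \<union> colour_class G c h')"
    using l(1) unfolding realizes_def by blast+
  interpret rung_insertion G a1 a2 b1 b2 a b
    using r(1) l assms(2-4) by unfold_locales auto
  let ?c = "c(a := c a1, b := c b1)"
  have pv: "pverts G' = insert a (insert b (pverts G))" by (simp add: G'_def)
  have c_old: "?c v = c v" if "v \<in> pverts G" for v using that neqs_fresh by simp
  have class1: "colour_class G' ?c h = ext (colour_class G c h)" for h
    using verts fresh l(8) by (auto simp: colour_class_def ext_def pv split: if_splits)
  have ext_Un: "ext (S \<union> T) = ext S \<union> ext T" for S T by (auto simp: ext_def)
  have class2: "colour_class G' ?c h \<union> colour_class G' ?c h' =
      ext (colour_class G c h \<union> colour_class G c h')" for h h'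
    by (simp only: class1 ext_Un)
  have in_class: "v \<in> colour_class G c h \<longleftrightarrow> c v = h" if "v \<in> {a1, a2, b1, b2}" for v h
    using that verts by (auto simp: colour_class_def)
  have cls: "S \<subseteq> pverts G \<and> (a1 \<in> S \<longleftrightarrow> a2 \<in> S) \<and> (b1 \<in> S \<longleftrightarrow> b2 \<in> S)"
    if "S = colour_class G c h \<union> colour_class G c h'" for S h h'
    using that in_class l(6,7) by (auto simp: colour_class_def)
  \<comment> \<open>For \<open>h = h'\<close> the union is a single class, so this covers classes as
    well as pairs.\<close>
  have iff: "connected_dominating_set G' (ext S) \<longleftrightarrow>
      (a1 \<in> S \<or> b1 \<in> S) \<and> connected_dominating_set G S"
    if "S = colour_class G c h \<union> colour_class G c h'" for S h h'
    using cds_ext_iff[of S] not_cds_ext[of S] cls[OF that] by blast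
  have "realizes G' ?c H"
    unfolding realizes_def
  proof (intro conjI ballI impI)
    show "subcubic G'" by (rule subcubic_G')
    have "?c ` pverts G' = c ` pverts G"
      using verts fresh c_old unfolding pv by (auto simp: image_iff)
    then show "?c ` pverts G' = pverts H" using r(2) by simp
    fix h assume h: "h \<in> pverts H"
    show "\<exists>h'\<in>pverts H. (h, h') \<in> parcs H" using r(4)[OF h] .
    show "\<not> connected_dominating_set G' (colour_class G' ?c h)"
      using iff[of "colour_class G c h" h h] r(3)[OF h] by (simp add: class1)
    show "(h, h') \<in> parcs H \<longleftrightarrow>
        connected_dominating_set G' (colour_class G' ?c h \<union> colour_class G' ?c h')"
      if "h' \<in> pverts H" "h \<noteq> h'" for h'
      unfolding class2 iff[OF refl] using r(5)[OF h that] cover[of h h'] in_class by auto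
  qed
  moreover have "?c a1 = c a1" "?c b1 = c b1" using c_old verts by simp_all
  moreover have "?c a = c a1" "?c b = c b1" using fresh(3) by simp_all
  ultimately have "ladder G' ?c H a1 a b1 b"
    unfolding ladder_def using path_in_G' rungs_in_G' l(8) cover by auto
  then show ?thesis using pv by blast
qed

lemma infinite_up_to_iso_if_ladder:
  assumes "ladder (G :: nat pair_pre_digraph) c H a1 a2 b1 b2"
    and H: "pair_wf_digraph H" "irrefl (parcs H)"
  shows "infinite_up_to_iso (defining_graphs H)"
proof (rule infinite_up_to_iso_if_card_unbounded)
  show "pair_wf_digraph G" if "G \<in> defining_graphs H" for G
    using that pair_wf_digraph_if_subcubic by (auto simp: defining_graphs_def)
  show "\<exists>G\<in>defining_graphs H. m \<le> card (pverts G)" for m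
  proof -
    have "\<exists>(G :: nat pair_pre_digraph) c a2 b2. ladder G c H a1 a2 b1 b2 \<and> m \<le> card (pverts G)"
    proof (induct m)
      case 0
      then show ?case using assms(1) by blast
    next
      case (Suc m)
      then obtain G :: "nat pair_pre_digraph" and c a2 b2
        where G: "ladder G c H a1 a2 b1 b2" "m \<le> card (pverts G)" by blast
      then have fin: "finite (pverts G)"
        by (auto simp: ladder_def realizes_def subcubic_iff)
      obtain a where a: "a \<notin> pverts G" using fin ex_new_if_finite by blast
      obtain b where b: "b \<notin> insert a (pverts G)"
        using fin ex_new_if_finite[of "insert a (pverts G)"] by auto
      then obtain G' where "pverts G' = insert a (insert b (pverts G))"
        "ladder G' (c(a := c a1, b := c b1)) H a1 a b1 b"
        using ladder_insert_rung[OF G(1) a, of b] by auto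
      moreover from this have "Suc m \<le> card (pverts G')" using G(2) a b fin by simp
      ultimately show ?case by blast
    qed
    then show ?thesis
      using defining_graphs_if_realizes[OF _ H] unfolding ladder_def by blast
  qed
qed

section \<open>Examples\<close>

definition check_edges :: "nat \<Rightarrow> (nat \<times> nat) list \<Rightarrow> bool" where
  "check_edges k es \<longleftrightarrow> (\<forall>e\<in>set es. fst e < k \<and> snd e < k \<and> fst e \<noteq> snd e)"

text \<open>By convention the vertices 0, 1, 2, 3 play the roles of \<open>a1\<close>,
  \<open>a2\<close>, \<open>b1\<close>, \<open>b2\<close>.\<close>

definition check_ladder :: "nat list list \<Rightarrow> nat list \<Rightarrow> nat \<Rightarrow> (nat \<times> nat) list \<Rightarrow> bool" where
  "check_ladder ns cs k es \<longleftrightarrow> check_edges k es \<and> check_realizes ns cs k es \<and> 3 < length ns \<and>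
     1 \<in> set (ns ! 0) \<and> 3 \<in> set (ns ! 2) \<and> 2 \<in> set (ns ! 0) \<and> 3 \<in> set (ns ! 1) \<and>
     cs ! 0 = cs ! 1 \<and> cs ! 2 = cs ! 3 \<and> cs ! 0 \<noteq> cs ! 2 \<and>
     (\<forall>e\<in>set es. cs ! 0 = fst e \<or> cs ! 0 = snd e \<or> cs ! 2 = fst e \<or> cs ! 2 = snd e)"

lemma graph_of_edges_if_check_edges:
  assumes "check_edges k es"
  shows "pair_wf_digraph (graph_of_edges k (set es))" "irrefl (parcs (graph_of_edges k (set es)))"
  using assms
  by (auto simp: check_edges_def irrefl_def intro!: pair_wf_digraph_graph_of_edges)

lemma defined_if_check_realizes:
  assumes "check_edges k es" "check_realizes ns cs k es"
  shows "defining_graphs (graph_of_edges k (set es)) \<noteq> {}"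
  using defining_graphs_if_realizes[OF realizes_if_check_realizes[OF assms(2)]
      graph_of_edges_if_check_edges[OF assms(1)]] by blast

lemma infinite_up_to_iso_if_check_ladder:
  assumes "check_ladder ns cs k es"
  shows "infinite_up_to_iso (defining_graphs (graph_of_edges k (set es)))"
proof (rule infinite_up_to_iso_if_ladder)
  have *: "check_edges k es" "check_realizes ns cs k es"
    using assms by (simp_all only: check_ladder_def)
  then show "pair_wf_digraph (graph_of_edges k (set es))" "irrefl (parcs (graph_of_edges k (set es)))"
    using graph_of_edges_if_check_edges by blast+
  have mem: "(u, v) \<in> parcs (nbr_list_graph ns) \<longleftrightarrow> v \<in> set (ns ! u)" if "u \<le> 3" for u v
    using assms that by (auto simp: nbr_list_graph_def check_ladder_def)
  have "cs ! 0 \<in> {h, h'} \<or> cs ! 2 \<in> {h, h'}" if "(h, h') \<in> set es \<union> (set es)\<inverse>" for h h'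
    using assms that unfolding check_ladder_def by fastforce
  then show "ladder (nbr_list_graph ns) ((!) cs) (graph_of_edges k (set es)) 0 1 2 3"
    using assms realizes_if_check_realizes[OF *(2)] mem
    by (simp add: ladder_def check_ladder_def)
qed

section \<open>Edge lists of the standard graphs, to be matched with the literal lists of the
  certificates\<close>

lemma path_graph_eq: "path_graph n = graph_of_edges n (set (map (\<lambda>i. (i, Suc i)) [0..<n - 1]))"
  by (auto simp: path_graph_def intro!: arg_cong[where f = "graph_of_edges n"])

lemma cycle_graph_eq: "cycle_graph n = graph_of_edges n (set (map (\<lambda>i. (i, Suc i mod n)) [0..<n]))"
  by (auto simp: cycle_graph_def intro!: arg_cong[where f = "graph_of_edges n"])

lemma matching_graph_eq:
  "matching_graph m = graph_of_edges (2 * m) (set (map (\<lambda>i. (2 * i, 2 * i + 1)) [0..<m]))"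
  by (auto simp: matching_graph_def intro!: arg_cong[where f = "graph_of_edges (2 * m)"])

lemma complete_graph_eq:
  "complete_graph n = graph_of_edges n (set (concat (map (\<lambda>j. map (\<lambda>i. (i, j)) [0..<j]) [0..<n])))"
  by (auto simp: complete_graph_def intro!: arg_cong[where f = "graph_of_edges n"])

lemma complete_bipartite_graph_eq:
  "complete_bipartite_graph p q = graph_of_edges (p + q) (set (List.product [0..<p] [p..<p + q]))"
  by (simp add: complete_bipartite_graph_def)

section \<open>Starting graphs for the insertion of rungs\<close>

lemma infinite_up_to_iso_cycle_graph_3: "infinite_up_to_iso (defining_graphs (cycle_graph 3))"
proof -
  \<comment> \<open>Neighbour lists, colours, number of colours and edges of \<open>H\<close>. The
    4-cycle is 0 1 3 2; its colours 0 and 1 cover the triangle.\<close>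
  have "check_ladder
      [[1, 2, 4], [0, 2, 3], [0, 1, 3], [1, 2, 5], [0, 5], [3, 4]]
      [0, 0, 1, 1, 2, 2] 3 [(0, 1), (1, 2), (2, 0)]"
    by code_simp
  from infinite_up_to_iso_if_check_ladder[OF this] show ?thesis
    by (simp add: cycle_graph_eq upt_rec flip: numeral_2_eq_2)
qed

lemma infinite_up_to_iso_matching_graph_2: "infinite_up_to_iso (defining_graphs (matching_graph 2))"
proof -
  have "check_ladder
      [[1, 2, 3], [0, 3, 5], [0, 3, 4], [0, 1, 2], [2, 5, 6], [1, 4, 6], [4, 5]]
      [0, 0, 2, 2, 3, 1, 3] 4 [(0, 1), (2, 3)]"
    by code_simp
  from infinite_up_to_iso_if_check_ladder[OF this] show ?thesis
    by (simp add: matching_graph_eq upt_rec flip: numeral_2_eq_2)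
qed

lemma infinite_up_to_iso_path_graph_4: "infinite_up_to_iso (defining_graphs (path_graph 4))"
proof -
  have "check_ladder
      [[1, 2, 5], [0, 2, 3], [0, 1, 3], [1, 2, 4], [3, 5], [0, 4]]
      [2, 2, 1, 1, 0, 3] 4 [(0, 1), (1, 2), (2, 3)]"
    by code_simp
  from infinite_up_to_iso_if_check_ladder[OF this] show ?thesis
    by (simp add: path_graph_eq upt_rec flip: numeral_2_eq_2)
qed

lemma infinite_up_to_iso_cycle_graph_4: "infinite_up_to_iso (defining_graphs (cycle_graph 4))"
proof -
  have "check_ladder
      [[1, 2, 5], [0, 3, 4], [0, 3, 4], [1, 2, 5], [1, 2, 6], [0, 3, 6], [4, 5]]
      [0, 0, 2, 2, 3, 1, 2] 4 [(0, 1), (1, 2), (2, 3), (3, 0)]"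
    by code_simp
  from infinite_up_to_iso_if_check_ladder[OF this] show ?thesis
    by (simp add: cycle_graph_eq upt_rec flip: numeral_2_eq_2)
qed

lemma infinite_up_to_iso_C3_plus_e: "infinite_up_to_iso (defining_graphs (C3_plus_e))"
proof -
  have "check_ladder
      [[1, 2, 4], [0, 3, 5], [0, 3, 6], [1, 2], [0, 5, 6], [1, 4, 6], [2, 4, 5]]
      [0, 0, 1, 1, 3, 2, 2] 4 [(0, 1), (1, 2), (2, 0), (0, 3)]"
    by code_simp
  from infinite_up_to_iso_if_check_ladder[OF this] show ?thesis
    by (simp add: C3_plus_e_def)
qed

lemma infinite_up_to_iso_K4_minus_e: "infinite_up_to_iso (defining_graphs (K4_minus_e))"
proof -
  have "check_ladder
      [[1, 2, 7], [0, 3, 4], [0, 3, 5], [1, 2, 6], [1, 5, 7], [2, 4, 6], [3, 5, 7], [0, 4, 6]]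
      [0, 0, 1, 1, 0, 3, 1, 2] 4 [(0, 1), (0, 2), (0, 3), (1, 2), (1, 3)]"
    by code_simp
  from infinite_up_to_iso_if_check_ladder[OF this] show ?thesis
    by (simp add: K4_minus_e_def)
qed

lemma infinite_up_to_iso_P2_union_P3: "infinite_up_to_iso (defining_graphs (P2_union_P3))"
proof -
  have "check_ladder
      [[1, 2, 5], [0, 3, 6], [0, 3, 7], [1, 2, 6], [5, 6, 7], [0, 4, 7], [1, 3, 4], [2, 4, 5]]
      [0, 0, 3, 3, 3, 1, 4, 2] 5 [(0, 1), (2, 3), (3, 4)]"
    by code_simp
  from infinite_up_to_iso_if_check_ladder[OF this] show ?thesis
    by (simp add: P2_union_P3_def)
qed

lemma infinite_up_to_iso_S12_graph: "infinite_up_to_iso (defining_graphs (S12_graph))"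
proof -
  have "check_ladder
      [[1, 2, 4], [0, 3, 6], [0, 3, 4], [1, 2, 5], [0, 2, 6], [3, 6], [1, 4, 5]]
      [3, 3, 0, 0, 2, 1, 4] 5 [(0, 1), (0, 2), (0, 3), (3, 4)]"
    by code_simp
  from infinite_up_to_iso_if_check_ladder[OF this] show ?thesis
    by (simp add: S12_graph_def)
qed

lemma infinite_up_to_iso_path_graph_5: "infinite_up_to_iso (defining_graphs (path_graph 5))"
proof -
  have "check_ladder
      [[1, 2, 5], [0, 3, 4], [0, 3, 4], [1, 2, 7], [1, 2, 6], [0, 6, 7], [4, 5, 7], [3, 5, 6]]
      [1, 1, 3, 3, 2, 0, 2, 4] 5 [(0, 1), (1, 2), (2, 3), (3, 4)]"
    by code_simp
  from infinite_up_to_iso_if_check_ladder[OF this] show ?thesis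
    by (simp add: path_graph_eq upt_rec flip: numeral_2_eq_2)
qed

lemma infinite_up_to_iso_C3_plus_e_plus_e: "infinite_up_to_iso (defining_graphs (C3_plus_e_plus_e))"
proof -
  have "check_ladder
      [[1, 2, 7], [0, 3, 4], [0, 3, 6], [1, 2, 5], [1, 5, 6], [3, 4, 7], [2, 4, 7], [0, 5, 6]]
      [0, 0, 1, 1, 2, 2, 4, 3] 5 [(0, 1), (1, 2), (2, 0), (0, 3), (1, 4)]"
    by code_simp
  from infinite_up_to_iso_if_check_ladder[OF this] show ?thesis
    by (simp add: C3_plus_e_plus_e_def)
qed

lemma infinite_up_to_iso_C3_plus_2e: "infinite_up_to_iso (defining_graphs (C3_plus_2e))"
proof -
  have "check_ladder
      [[1, 2, 4], [0, 3, 5], [0, 3, 11], [1, 2, 4], [0, 3, 6], [1, 7, 10], [4, 8, 11], [5, 9, 11], [6, 9, 10], [7, 8, 10], [5, 8, 9], [2, 6, 7]]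
      [0, 0, 1, 1, 4, 0, 0, 2, 0, 2, 3, 1] 5 [(0, 1), (1, 2), (2, 0), (0, 3), (0, 4)]"
    by code_simp
  from infinite_up_to_iso_if_check_ladder[OF this] show ?thesis
    by (simp add: C3_plus_2e_def)
qed

lemma infinite_up_to_iso_C4_plus_e: "infinite_up_to_iso (defining_graphs (C4_plus_e))"
proof -
  have "check_ladder
      [[1, 2, 8], [0, 3, 5], [0, 3, 7], [1, 2, 6], [5, 7, 8], [1, 4, 6], [3, 5, 8], [2, 4], [0, 4, 6]]
      [2, 2, 0, 0, 2, 3, 0, 4, 1] 5 [(0, 1), (1, 2), (2, 3), (3, 0), (0, 4)]"
    by code_simp
  from infinite_up_to_iso_if_check_ladder[OF this] show ?thesis
    by (simp add: C4_plus_e_def)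
qed

lemma infinite_up_to_iso_S22_graph: "infinite_up_to_iso (defining_graphs (S22_graph))"
proof -
  have "check_ladder
      [[1, 2, 5], [0, 3, 7], [0, 3, 6], [1, 2, 4], [3, 5, 7], [0, 4, 6], [2, 5, 7], [1, 4, 6]]
      [0, 0, 1, 1, 4, 2, 5, 3] 6 [(0, 1), (0, 2), (0, 3), (1, 4), (1, 5)]"
    by code_simp
  from infinite_up_to_iso_if_check_ladder[OF this] show ?thesis
    by (simp add: S22_graph_def)
qed

section \<open>Hosts for the graphs defined finitely often\<close>

lemma complete_graph_4_defined: "defining_graphs (complete_graph 4) \<noteq> {}"
proof -
  have "check_edges 4 [(0, 1), (0, 2), (0, 3), (1, 2), (1, 3), (2, 3)]"
    "check_realizes
      [[1, 2, 5], [0, 3, 7], [0, 3, 6], [1, 2, 4], [3, 6, 7], [0, 6, 7], [2, 4, 5], [1, 4, 5]]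
      [0, 0, 1, 1, 3, 2, 2, 3] 4 [(0, 1), (0, 2), (0, 3), (1, 2), (1, 3), (2, 3)]"
    by code_simp+
  from defined_if_check_realizes[OF this] show ?thesis
    by (simp add: complete_graph_eq upt_rec insert_commute flip: numeral_2_eq_2)
qed

lemma cycle_graph_5_defined: "defining_graphs (cycle_graph 5) \<noteq> {}"
proof -
  have "check_edges 5 [(0, 1), (1, 2), (2, 3), (3, 4), (4, 0)]"
    "check_realizes
      [[1, 2, 7], [0, 3, 6], [0, 3, 4], [1, 2, 5], [2, 6, 7], [3, 6, 7], [1, 4, 5], [0, 4, 5]]
      [1, 2, 4, 0, 3, 0, 3, 1] 5 [(0, 1), (1, 2), (2, 3), (3, 4), (4, 0)]"
    by code_simp+
  from defined_if_check_realizes[OF this] show ?thesis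
    by (simp add: cycle_graph_eq upt_rec flip: numeral_2_eq_2)
qed

text \<open>The host is the prism with single vertices as classes. Its three rungs join the
  triangles 0 1 5 and 2 3 4 and are its only connected dominating pairs: an edge of a triangle
  misses a vertex of the other triangle.\<close>

lemma matching_graph_3_defined: "defining_graphs (matching_graph 3) \<noteq> {}"
proof -
  have "check_edges 6 [(0, 1), (2, 3), (4, 5)]"
    "check_realizes
      [[1, 2, 5], [0, 3, 5], [0, 3, 4], [1, 2, 4], [2, 3, 5], [0, 1, 4]]
      [5, 1, 4, 0, 3, 2] 6 [(0, 1), (2, 3), (4, 5)]"
    by code_simp+
  from defined_if_check_realizes[OF this] show ?thesis
    by (simp add: matching_graph_eq upt_rec flip: numeral_2_eq_2)
qed

text \<open>The host is \<open>K_{2,3}\<close> itself with single vertices as classes: adjacent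
  vertices dominate both sides. The same idea gives \<open>K_{3,3}\<close>.\<close>

lemma complete_bipartite_graph_2_3_defined: "defining_graphs (complete_bipartite_graph 2 3) \<noteq> {}"
proof -
  have "check_edges 5 [(0, 2), (0, 3), (0, 4), (1, 2), (1, 3), (1, 4)]"
    "check_realizes
      [[1, 2], [0, 3, 4], [0, 3, 4], [1, 2], [1, 2]]
      [2, 0, 1, 3, 4] 5 [(0, 2), (0, 3), (0, 4), (1, 2), (1, 3), (1, 4)]"
    by code_simp+
  from defined_if_check_realizes[OF this] show ?thesis
    by (simp add: complete_bipartite_graph_eq upt_rec flip: numeral_2_eq_2)
qed

lemma complete_bipartite_graph_3_3_defined: "defining_graphs (complete_bipartite_graph 3 3) \<noteq> {}"
proof -
  have "check_edges 6 [(0, 3), (0, 4), (0, 5), (1, 3), (1, 4), (1, 5), (2, 3), (2, 4), (2, 5)]"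
    "check_realizes
      [[1, 2, 4], [0, 3, 5], [0, 3, 5], [1, 2, 4], [0, 3, 5], [1, 2, 4]]
      [5, 1, 2, 3, 0, 4] 6 [(0, 3), (0, 4), (0, 5), (1, 3), (1, 4), (1, 5), (2, 3), (2, 4), (2, 5)]"
    by code_simp+
  from defined_if_check_realizes[OF this] show ?thesis
    by (simp add: complete_bipartite_graph_eq upt_rec flip: numeral_2_eq_2)
qed

section \<open>Stars\<close>

text \<open>
  Two disjoint paths on the vertices \<open>3 i\<close> and \<open>3 i + 1\<close>, which together form the centre of the
  star, and one vertex \<open>3 i + 2\<close> for every leaf, joining the two paths.
\<close>

definition star_host :: "nat \<Rightarrow> nat \<Rightarrow> nat pair_pre_digraph" where
  "star_host k N =
     \<lparr>pverts = {v. v div 3 < N \<and> (v mod 3 = 2 \<longrightarrow> v div 3 < k)},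
      parcs = (let F = {(3 * i, 3 * Suc i) | i. Suc i < N} \<union> {(3 * i + 1, 3 * Suc i + 1) | i. Suc i < N} \<union>
          {(3 * i, 3 * i + 2) | i. i < k} \<union> {(3 * i + 1, 3 * i + 2) | i. i < k} in F \<union> F\<inverse>)\<rparr>"

lemma Suc_div_mod_3 [simp]: "Suc (3 * i) div 3 = i" "Suc (3 * i) mod 3 = 1"
  "Suc (Suc (3 * i)) div 3 = i" "Suc (Suc (3 * i)) mod 3 = 2"
  by presburger+

context
  fixes k N :: nat
  assumes k: "1 \<le> k" and N: "k \<le> N" "2 \<le> N"
begin

abbreviation "SG \<equiv> star_host k N"

abbreviation "paths \<equiv> {v. v div 3 < N \<and> v mod 3 \<noteq> 2}"

lemma mem_star_host: "v \<in> pverts SG \<longleftrightarrow> v div 3 < N \<and> (v mod 3 = 2 \<longrightarrow> v div 3 < k)"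
  by (simp add: star_host_def)

lemma sym_star_host: "sym (parcs SG)"
proof -
  have "sym (F \<union> F\<inverse>)" for F :: "nat rel" by (auto simp: sym_def)
  then show ?thesis by (simp add: star_host_def Let_def)
qed

lemma star_host_arcs:
  "Suc i < N \<Longrightarrow> (3 * i, 3 * Suc i) \<in> parcs SG"
  "Suc i < N \<Longrightarrow> (3 * i + 1, 3 * Suc i + 1) \<in> parcs SG"
  "i < k \<Longrightarrow> (3 * i, 3 * i + 2) \<in> parcs SG"
  "i < k \<Longrightarrow> (3 * i + 1, 3 * i + 2) \<in> parcs SG"
  by (simp_all add: star_host_def Let_def)

lemma star_host_arcsE:
  assumes "(u, v) \<in> parcs SG"
  obtains i where "Suc i < N" "{u, v} = {3 * i, 3 * Suc i}"
    | i where "Suc i < N" "{u, v} = {3 * i + 1, 3 * Suc i + 1}"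
    | i where "i < k" "{u, v} = {3 * i, 3 * i + 2}"
    | i where "i < k" "{u, v} = {3 * i + 1, 3 * i + 2}"
proof -
  consider (a) i where "Suc i < N" "(u, v) = (3 * i, 3 * Suc i) \<or> (v, u) = (3 * i, 3 * Suc i)"
    | (b) i where "Suc i < N" "(u, v) = (3 * i + 1, 3 * Suc i + 1) \<or> (v, u) = (3 * i + 1, 3 * Suc i + 1)"
    | (c) i where "i < k" "(u, v) = (3 * i, 3 * i + 2) \<or> (v, u) = (3 * i, 3 * i + 2)"
    | (d) i where "i < k" "(u, v) = (3 * i + 1, 3 * i + 2) \<or> (v, u) = (3 * i + 1, 3 * i + 2)"
    using assms unfolding star_host_def Let_def pair_pre_digraph.simps Un_iff converse_iff mem_Collect_eq
    by (elim disjE exE conjE) (use that in blast)+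
  then show thesis
    by cases (use that in blast)+
qed

text \<open>Arcs run along one of the paths or join a leaf vertex to a path vertex of the same
  index. All failures of adjacency below are read off from this.\<close>

lemma star_host_arc_mod:
  assumes "(u, v) \<in> parcs SG"
  shows "u mod 3 = v mod 3 \<and> u mod 3 \<noteq> 2 \<or>
    u div 3 = v div 3 \<and> (u mod 3 \<noteq> 2 \<and> v mod 3 = 2 \<or> u mod 3 = 2 \<and> v mod 3 \<noteq> 2)"
  using assms
  by (cases rule: star_host_arcsE) (auto simp: doubleton_eq_iff)

text \<open>One vertex of \<open>R\<close> already links the two paths. A single leaf vertex gives
  the coalition with the centre, all of them give connectedness of the whole graph.\<close>

lemma star_host_cds:
  assumes R: "R \<subseteq> {v. v div 3 < k \<and> v mod 3 = 2}" "R \<noteq> {}"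
  shows "connected_dominating_set SG (paths \<union> R)"
proof -
  let ?S = "paths \<union> R" and ?Q = "parcs SG \<inter> (paths \<union> R) \<times> (paths \<union> R)"
  have sym: "sym (?Q\<^sup>*)" using sym_star_host by (intro sym_rtrancl) (auto simp: sym_def)
  have a: "(0, 3 * i) \<in> ?Q\<^sup>*" if "i < N" for i
    using that
  proof (induct i)
    case (Suc i)
    then have "(3 * i, 3 * Suc i) \<in> ?Q" using star_host_arcs(1)[of i] by auto
    with Suc show ?case by (meson Suc_lessD rtrancl.rtrancl_into_rtrancl)
  qed simp
  have b: "(1, 3 * i + 1) \<in> ?Q\<^sup>*" if "i < N" for i
    using that
  proof (induct i)
    case (Suc i)
    then have "(3 * i + 1, 3 * Suc i + 1) \<in> ?Q" using star_host_arcs(2)[of i] by auto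
    with Suc show ?case by (meson Suc_lessD rtrancl.rtrancl_into_rtrancl)
  qed simp
  have r: "(3 * i, 3 * i + 2) \<in> ?Q" "(3 * i + 1, 3 * i + 2) \<in> ?Q" "i < N" if "3 * i + 2 \<in> R" for i
  proof -
    have "i < k" using that R(1) by auto
    then show "i < N" using N by simp
    then show "(3 * i, 3 * i + 2) \<in> ?Q" "(3 * i + 1, 3 * i + 2) \<in> ?Q"
      using that \<open>i < k\<close> star_host_arcs(3,4)[of i] by auto
  qed
  have R_shape: "v = 3 * (v div 3) + 2" if "v \<in> R" for v
  proof -
    have "v mod 3 = 2" using that R(1) by auto
    then show ?thesis by presburger
  qed
  have c: "(0, 1) \<in> ?Q\<^sup>*"
  proof -
    obtain i where i: "3 * i + 2 \<in> R" using R(2) R_shape by (metis ex_in_conv)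
    have "(0, 3 * i + 2) \<in> ?Q\<^sup>*" using a[of i] r[OF i] by (meson rtrancl.rtrancl_into_rtrancl)
    moreover have "(1, 3 * i + 2) \<in> ?Q\<^sup>*" using b[of i] r[OF i] by (meson rtrancl.rtrancl_into_rtrancl)
    ultimately show ?thesis using sym by (meson rtrancl_trans symD)
  qed
  have from0: "(0, v) \<in> ?Q\<^sup>*" if "v \<in> ?S" for v
  proof (cases "v \<in> R")
    case True
    then obtain i where i: "v = 3 * i + 2" using R_shape by blast
    with True have "3 * i + 2 \<in> R" by simp
    from r[OF this] a[of i] show ?thesis unfolding i by (meson rtrancl.rtrancl_into_rtrancl)
  next
    case False
    then have v: "v div 3 < N" "v mod 3 \<noteq> 2" using that by auto
    define i where "i = v div 3"
    have "v = 3 * i \<or> v = 3 * i + 1" using v(2) unfolding i_def by presburger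
    moreover have "(0, 3 * i) \<in> ?Q\<^sup>*" "(0, 3 * i + 1) \<in> ?Q\<^sup>*"
      using a[of i] rtrancl_trans[OF c b[of i]] v(1) by (simp_all add: i_def)
    ultimately show ?thesis by blast
  qed
  have "conn (parcs SG) ?S"
    unfolding conn_def
  proof (intro conjI ballI)
    show "(u, v) \<in> ?Q\<^sup>*" if "u \<in> ?S" "v \<in> ?S" for u v
      using from0[OF that(1)] from0[OF that(2)] sym by (meson rtrancl_trans symD)
  qed (use R in blast)
  moreover have "?S \<subseteq> pverts SG" using R N by (auto simp: mem_star_host)
  moreover have "\<exists>u\<in>?S. (v, u) \<in> parcs SG" if "v \<in> pverts SG - ?S" for v
  proof -
    have v: "v mod 3 = 2" "v div 3 < k" using that by (auto simp: mem_star_host)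
    then have "v = 3 * (v div 3) + 2" by presburger
    then have "(v, 3 * (v div 3)) \<in> parcs SG"
      using star_host_arcs(3)[OF v(2)] sym_star_host by (metis symD)
    moreover have "3 * (v div 3) \<in> paths" using v N by simp
    ultimately show ?thesis by blast
  qed
  ultimately show ?thesis by (simp add: connected_dominating_set_iff[OF sym_star_host])
qed

text \<open>The paths do dominate; what fails is connectedness, as no arc joins residues 0 and
  1.\<close>

lemma star_host_not_cds_paths: "\<not> connected_dominating_set SG paths"
proof
  assume "connected_dominating_set SG paths"
  then have con: "conn (parcs SG) paths" by (simp add: connected_dominating_set_iff[OF sym_star_host])
  let ?T = "{v \<in> paths. v mod 3 = 0}"
  have mem: "0 \<in> ?T" "1 \<in> paths" "1 \<notin> ?T" using N by auto
  have "?T \<subseteq> paths" by (rule Collect_restrict)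
  moreover have "?T \<noteq> {}" using mem(1) by (metis (lifting) empty_iff)
  moreover have "?T \<noteq> paths" using mem(2,3) by (metis (lifting))
  ultimately obtain u v where uv: "u \<in> ?T" "v \<in> paths - ?T" "(u, v) \<in> parcs SG"
    by (rule conn_exit[OF con])
  from star_host_arc_mod[OF uv(3)] uv(1,2) show False by auto
qed

text \<open>With \<open>r = r'\<close> allowed, this covers single leaf classes and pairs of them
  alike.\<close>

lemma star_host_not_cds_leaves:
  assumes "r mod 3 = 2" "r' mod 3 = 2"
  shows "\<not> connected_dominating_set SG {r, r'}"
proof
  assume cds: "connected_dominating_set SG {r, r'}"
  have "r = r'"
  proof (rule ccontr)
    assume "r \<noteq> r'"
    moreover have con: "conn (parcs SG) {r, r'}"
      using cds by (simp add: connected_dominating_set_iff[OF sym_star_host])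
    ultimately obtain u v where uv: "u \<in> {r}" "v \<in> {r, r'} - {r}" "(u, v) \<in> parcs SG"
      by (rule_tac conn_exit[of "parcs SG" "{r, r'}" "{r}"]) auto
    from star_host_arc_mod[OF uv(3)] uv(1,2) assms show False by auto
  qed
  \<comment> \<open>A vertex of the first path with an index other than that of \<open>r\<close>; it
    exists because \<open>N \<ge> 2\<close>.\<close>
  define v :: nat where "v = (if r div 3 = 0 then 3 else 0)"
  have v: "v \<in> pverts SG" "v mod 3 = 0" "v div 3 \<noteq> r div 3" using N by (auto simp: mem_star_host v_def)
  then have "v \<in> pverts SG - {r, r'}" using assms by auto
  then have "(v, r) \<in> parcs SG"
    using cds \<open>r = r'\<close> by (auto simp: connected_dominating_set_iff[OF sym_star_host])
  from star_host_arc_mod[OF this] v assms show False by auto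
qed

lemma subcubic_star_host: "subcubic SG"
  unfolding subcubic_iff
proof (intro conjI ballI)
  have "pverts SG \<subseteq> {..<3 * N}" using N by (auto simp: mem_star_host)
  then show "finite (pverts SG)" using finite_subset by blast
  show "parcs SG \<subseteq> pverts SG \<times> pverts SG"
  proof (rule subrelI)
    fix u v assume "(u, v) \<in> parcs SG"
    then show "(u, v) \<in> pverts SG \<times> pverts SG"
      using N by (cases rule: star_host_arcsE) (auto simp: doubleton_eq_iff mem_star_host)
  qed
  show "sym (parcs SG)" by (rule sym_star_host)
  show "irrefl (parcs SG)"
    unfolding irrefl_def
  proof (intro allI notI)
    fix v assume "(v, v) \<in> parcs SG"
    then show False by (cases rule: star_host_arcsE) (auto simp: doubleton_eq_iff)
  qed
  let ?R = "{v. v div 3 < k \<and> v mod 3 = (2 :: nat)}"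
  have "2 \<in> ?R" using k by simp
  then have "connected_dominating_set SG (paths \<union> ?R)" by (intro star_host_cds) blast+
  moreover have "paths \<union> ?R = pverts SG" using N by (auto simp: mem_star_host)
  ultimately show "conn (parcs SG) (pverts SG)"
    by (simp add: connected_dominating_set_iff[OF sym_star_host])
  fix v assume "v \<in> pverts SG"
  \<comment> \<open>The list only has to contain all neighbours: entries beyond the ends of a path,
    including those from truncated subtraction, do no harm.\<close>
  define l where "l = (if v mod 3 = 2 then [v - 1, v - 2] else [v + 3, v - 3, 3 * (v div 3) + 2])"
  have "u \<in> set l" if "(v, u) \<in> parcs SG" for u
    using that unfolding l_def by (cases rule: star_host_arcsE) (auto simp: doubleton_eq_iff)
  then have "parcs SG `` {v} \<subseteq> set l" by blast
  then have "card (parcs SG `` {v}) \<le> card (set l)" by (intro card_mono) auto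
  also have "\<dots> \<le> 3" using card_length[of l] by (simp add: l_def split: if_splits)
  finally show "card (parcs SG `` {v}) \<le> 3" .
qed

lemma star_graph_Suc: "pverts (star_graph (Suc k)) = {0..<Suc k}"
  "(h, h') \<in> parcs (star_graph (Suc k)) \<longleftrightarrow>
     h = 0 \<and> 1 \<le> h' \<and> h' \<le> k \<or> h' = 0 \<and> 1 \<le> h \<and> h \<le> k"
  by (auto simp: star_graph_def complete_bipartite_graph_def)

lemma star_host_realizes:
  "realizes SG (\<lambda>v. if v mod 3 = 2 then Suc (v div 3) else 0) (star_graph (Suc k))"
proof -
  let ?c = "\<lambda>v :: nat. if v mod 3 = 2 then Suc (v div 3) else 0"
  have cls0: "colour_class SG ?c 0 = paths" using N by (auto simp: colour_class_def mem_star_host)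
  have cls: "colour_class SG ?c (Suc i) = {3 * i + 2}" if "i < k" for i
  proof -
    have "x mod 3 = 2 \<and> x div 3 = i \<longleftrightarrow> x = 3 * i + 2" for x by presburger
    then have "colour_class SG ?c (Suc i) = {x \<in> pverts SG. x = 3 * i + 2}"
      by (auto simp: colour_class_def)
    moreover have "3 * i + 2 \<in> pverts SG" using that N by (simp add: mem_star_host)
    ultimately show ?thesis by (simp only:) blast
  qed
  have cds0: "connected_dominating_set SG (paths \<union> {3 * i + 2})" if "i < k" for i
    using that by (intro star_host_cds) auto
  have ncds: "\<not> connected_dominating_set SG ({3 * i + 2} \<union> {3 * j + 2})" for i j
    using star_host_not_cds_leaves[of "3 * i + 2" "3 * j + 2"] by (simp add: insert_commute)
  show ?thesis
    unfolding realizes_def star_graph_Suc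
  proof (intro conjI ballI impI)
    show "subcubic SG" by (rule subcubic_star_host)
    show "?c ` pverts SG = {0..<Suc k}"
    proof
      show "?c ` pverts SG \<subseteq> {0..<Suc k}" by (auto simp: mem_star_host)
      have "h \<in> ?c ` pverts SG" if "h \<le> k" for h
      proof (cases h)
        case 0
        then show ?thesis using N by (intro image_eqI[of _ _ 0]) (auto simp: mem_star_host)
      next
        case (Suc i)
        then show ?thesis using N that
          by (intro image_eqI[of _ _ "3 * i + 2"]) (auto simp: mem_star_host)
      qed
      then show "{0..<Suc k} \<subseteq> ?c ` pverts SG"
        unfolding atLeast0LessThan lessThan_Suc_atMost atMost_def by blast
    qed
    fix h assume h: "h \<in> {0..<Suc k}"
    show "\<not> connected_dominating_set SG (colour_class SG ?c h)"
    proof (cases h)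
      case 0
      then show ?thesis using star_host_not_cds_paths by (simp only: cls0 not_False_eq_True)
    next
      case (Suc i)
      then have "colour_class SG ?c h = {3 * i + 2}" using h cls[of i] by simp
      then show ?thesis using ncds[of i i] by (simp only: Un_absorb not_False_eq_True)
    qed
    show "\<exists>h'\<in>{0..<Suc k}. h = 0 \<and> 1 \<le> h' \<and> h' \<le> k \<or> h' = 0 \<and> 1 \<le> h \<and> h \<le> k"
      using h k by (intro bexI[of _ "if h = 0 then 1 else 0"]) auto
    fix h' assume h': "h' \<in> {0..<Suc k}" and ne: "h \<noteq> h'"
    show "h = 0 \<and> 1 \<le> h' \<and> h' \<le> k \<or> h' = 0 \<and> 1 \<le> h \<and> h \<le> k \<longleftrightarrow>
        connected_dominating_set SG (colour_class SG ?c h \<union> colour_class SG ?c h')"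
    proof (cases h; cases h')
      fix j assume "h = 0" "h' = Suc j"
      then show ?thesis using cds0[of j] cls[of j] cls0 h' by simp
    next
      fix i assume "h = Suc i" "h' = 0"
      then show ?thesis using cds0[of i] cls[of i] cls0 h by (simp add: Un_commute)
    next
      fix i j assume "h = Suc i" "h' = Suc j"
      then show ?thesis using ncds[of i j] cls[of i] cls[of j] h h' by simp
    qed (use ne in simp)
  qed
qed

lemma card_star_host: "N \<le> card (pverts SG)"
proof -
  have "card ((\<lambda>i. 3 * i) ` {..<N}) \<le> card (pverts SG)"
    using subcubic_star_host
    by (intro card_mono) (auto simp: subcubic_iff mem_star_host)
  then show ?thesis by (simp add: card_image inj_on_def)
qed

end

lemma infinite_up_to_iso_star_graph:
  assumes "2 \<le> n"
  shows "infinite_up_to_iso (defining_graphs (star_graph n))"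
proof (rule infinite_up_to_iso_if_card_unbounded)
  show "pair_wf_digraph G" if "G \<in> defining_graphs (star_graph n)" for G
    using that pair_wf_digraph_if_subcubic by (auto simp: defining_graphs_def)
  fix m
  obtain k where k: "n = Suc k" "1 \<le> k" using assms by (cases n) auto
  \<comment> \<open>The star fixes the number \<open>k\<close> of leaves; the order grows through
    the length \<open>N\<close> of the paths alone.\<close>
  define N where "N = k + m + 2"
  have N: "k \<le> N" "2 \<le> N" "m \<le> N" by (simp_all add: N_def)
  have wf: "pair_wf_digraph (star_graph n)"
    unfolding star_graph_def complete_bipartite_graph_def
    by (intro pair_wf_digraph_graph_of_edges) auto
  have "irrefl (parcs (star_graph n))"
    by (auto simp: star_graph_def complete_bipartite_graph_def irrefl_def)
  with wf have "star_host k N \<in> defining_graphs (star_graph n)"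
    using defining_graphs_if_realizes star_host_realizes[OF k(2) N(1,2)] k(1) by blast
  moreover have "m \<le> card (pverts (star_host k N))"
    using card_star_host[OF k(2) N(1,2)] N(3) by linarith
  ultimately show "\<exists>G\<in>defining_graphs (star_graph n). m \<le> card (pverts G)" by blast
qed

theorem theorem2:
  shows "(\<forall>H \<in> {complete_graph 1, edgeless_graph 2, edgeless_graph 3, complete_graph 4,
             edgeless_graph 4, cycle_graph 5, matching_graph 3,
             complete_bipartite_graph 2 3, complete_bipartite_graph 3 3}.
            defining_graphs H \<noteq> {} \<and> finite_up_to_iso (defining_graphs H)) \<and>
         (\<forall>H \<in> {cycle_graph 3, matching_graph 2, path_graph 4, cycle_graph 4, C3_plus_e,
             K4_minus_e, P2_union_P3, S12_graph, path_graph 5, C3_plus_e_plus_e, C3_plus_2e,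
             C4_plus_e, S22_graph}.
            infinite_up_to_iso (defining_graphs H)) \<and>
         (\<forall>k \<ge> 2. infinite_up_to_iso (defining_graphs (star_graph k)))"
proof (intro conjI)
  have edgeless: "defining_graphs (edgeless_graph n) \<noteq> {} \<and> finite_up_to_iso (defining_graphs (edgeless_graph n))"
    if "1 \<le> n" "n \<le> 4" for n
    using edgeless_graph_defined[OF that] finite_up_to_iso_edgeless_graph by blast
  have one: "defining_graphs (complete_graph 1) \<noteq> {} \<and> finite_up_to_iso (defining_graphs (complete_graph 1))"
    unfolding complete_graph_1 by (rule edgeless) simp_all
  show "\<forall>H \<in> {complete_graph 1, edgeless_graph 2, edgeless_graph 3, complete_graph 4,
             edgeless_graph 4, cycle_graph 5, matching_graph 3,
             complete_bipartite_graph 2 3, complete_bipartite_graph 3 3}.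
            defining_graphs H \<noteq> {} \<and> finite_up_to_iso (defining_graphs H)"
    unfolding ball_simps
    by (intro conjI TrueI one[THEN conjunct1] one[THEN conjunct2]
      edgeless[THEN conjunct1] edgeless[THEN conjunct2]
      complete_graph_4_defined finite_up_to_iso_complete_graph_4
      cycle_graph_5_defined finite_up_to_iso_cycle_graph_5
      matching_graph_3_defined finite_up_to_iso_matching_graph_3
      complete_bipartite_graph_2_3_defined finite_up_to_iso_complete_bipartite_graph_2_3
      complete_bipartite_graph_3_3_defined finite_up_to_iso_complete_bipartite_graph_3_3; simp)
  show "\<forall>H \<in> {cycle_graph 3, matching_graph 2, path_graph 4, cycle_graph 4, C3_plus_e,
             K4_minus_e, P2_union_P3, S12_graph, path_graph 5, C3_plus_e_plus_e, C3_plus_2e,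
             C4_plus_e, S22_graph}.
            infinite_up_to_iso (defining_graphs H)"
    unfolding ball_simps
    by (intro conjI TrueI infinite_up_to_iso_cycle_graph_3 infinite_up_to_iso_matching_graph_2
      infinite_up_to_iso_path_graph_4 infinite_up_to_iso_cycle_graph_4 infinite_up_to_iso_C3_plus_e
      infinite_up_to_iso_K4_minus_e infinite_up_to_iso_P2_union_P3 infinite_up_to_iso_S12_graph
      infinite_up_to_iso_path_graph_5 infinite_up_to_iso_C3_plus_e_plus_e
      infinite_up_to_iso_C3_plus_2e infinite_up_to_iso_C4_plus_e infinite_up_to_iso_S22_graph)
  show "\<forall>k \<ge> 2. infinite_up_to_iso (defining_graphs (star_graph k))"
    using infinite_up_to_iso_star_graph by blast
qed

end
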